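(* Let $A,B$ be quantum systems of finite dimensions $d_A,d_B$ with $d_Ad_B\le 6$, and let $\rho^{AB}$ be a quantum state on $AB$. Let $$F_{\rightarrow}^{A|B}(\rho^{AB})=\max\sum_i\mathrm{Tr}\left[(M_i^A\otimes\mu_i^B)\,\rho^{AB}\right],$$ where the maximum is over all POVMs $\{M_i^A\}$ on $A$ and all families of quantum states $\{\mu_i^B\}$ on $B$. Then $$F_{\rightarrow}^{A|B}(\rho^{AB})=\max_{X^{AB}}\mathrm{Tr}\left[X^{AB}\rho^{AB}\right],$$ where the maximum is over all matrices $X^{AB}$ on $AB$ satisfying $$X^{AB}\ge 0,\qquad X^{T_B}\ge 0,\qquad X^A=\mathbb{1}_A .$$
   Context: $X^{T_B}$ denotes the partial transpose of $X^{AB}$ with respect to $B$, and $X^A=\mathrm{Tr}_B[X^{AB}]$. A POVM on $A$ is a finite family of positive semidefinite operators $M_i^A$ with $\sum_i M_i^A=\mathbb{1}_A$. Equivalently, $F_{\rightarrow}^{A|B}(\rho^{AB})=\max\sum_i p_i\lambda_{\max}(\sigma_i^B)$, where $p_i=\mathrm{Tr}[(M_i^A\otimes\mathbb{1}^B)\rho^{AB}]$, $\sigma_i^B=\mathrm{Tr}_A[(M_i^A\otimes\mathbb{1}^B)\rho^{AB}]/p_i$, $\lambda_{\max}$ is the largest eigenvalue, and the maximum is over POVMs on $A$: it is the maximal fidelity of Bob's system with its ground state (for fully degenerate local Hamiltonians) when Alice measures $A$ and communicates her outcome to Bob. *)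

theory Defs
  imports "HOL-Analysis.Analysis"
begin

text \<open>
  A system of dimension \<open>d\<close> is \<open>\<complex>\<^sup>d\<close>, indexed by a finite type with \<open>d\<close> elements; operators on the
  composite system are matrices indexed by pairs.
\<close>

type_synonym 'n cmat = "complex^'n^'n"

definition hermitian :: "('n::finite) cmat \<Rightarrow> bool" where
  "hermitian X \<longleftrightarrow> map_matrix cnj (transpose X) = X"

text \<open>
  For Hermitian \<open>X\<close> the sum below is real, so taking \<open>Re\<close> is only a change of type.
\<close>

definition psd :: "('n::finite) cmat \<Rightarrow> bool" where
  "psd X \<longleftrightarrow> hermitian X \<and> (\<forall>v. 0 \<le> Re (\<Sum>i\<in>UNIV. cnj (v $ i) * (X *v v) $ i))"

definition quantum_state :: "('n::finite) cmat \<Rightarrow> bool" where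
  "quantum_state \<rho> \<longleftrightarrow> psd \<rho> \<and> trace \<rho> = 1"

definition kron :: "('a::finite) cmat \<Rightarrow> ('b::finite) cmat \<Rightarrow> ('a \<times> 'b) cmat" where
  "kron M N = (\<chi> p q. M $ fst p $ fst q * N $ snd p $ snd q)"

definition ptranspose_B :: "('a::finite \<times> 'b::finite) cmat \<Rightarrow> ('a \<times> 'b) cmat" where
  "ptranspose_B X = (\<chi> p q. X $ (fst p, snd q) $ (fst q, snd p))"

definition ptrace_B :: "('a::finite \<times> 'b::finite) cmat \<Rightarrow> 'a cmat" where
  "ptrace_B X = (\<chi> i j. \<Sum>k\<in>UNIV. X $ (i, k) $ (j, k))"

text \<open>
  A POVM with outcomes \<open>0, \<dots>, n - 1\<close>; values of \<open>M\<close> at \<open>i \<ge> n\<close> are irrelevant.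
\<close>

definition povm :: "nat \<Rightarrow> (nat \<Rightarrow> ('a::finite) cmat) \<Rightarrow> bool" where
  "povm n M \<longleftrightarrow> (\<forall>i<n. psd (M i)) \<and> (\<Sum>i<n. M i) = mat 1"

text \<open>
  The values over which the two maxima are taken. All traces are of products of two positive
  semidefinite matrices, hence real.
\<close>

definition one_way_values :: "('a::finite \<times> 'b::finite) cmat \<Rightarrow> real set" where
  "one_way_values \<rho> =
     {\<Sum>i<n. Re (trace (kron (M i) (\<mu> i) ** \<rho>)) | n M \<mu>.
        povm n M \<and> (\<forall>i<n. quantum_state (\<mu> i))}"

definition ppt_values :: "('a::finite \<times> 'b::finite) cmat \<Rightarrow> real set" where
  "ppt_values \<rho> =
     {Re (trace (X ** \<rho>)) | X. psd X \<and> psd (ptranspose_B X) \<and> ptrace_B X = mat 1}"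

text \<open>
  \<open>max_of S\<close> is meaningful only when \<open>has_max S\<close> holds; \<open>Max\<close> would not do, since the sets of values
  are infinite in general.
\<close>

definition has_max :: "real set \<Rightarrow> bool" where
  "has_max S \<longleftrightarrow> (\<exists>m\<in>S. \<forall>s\<in>S. s \<le> m)"

definition max_of :: "real set \<Rightarrow> real" where
  "max_of S = (GREATEST m. m \<in> S)"

definition one_way_fidelity :: "('a::finite \<times> 'b::finite) cmat \<Rightarrow> real" where
  "one_way_fidelity \<rho> = max_of (one_way_values \<rho>)"

end

(*
The substance is that a PPT operator X on a system of dimension at most 6 is separable
(Stormer, Woronowicz): then X^A = 1 makes X = sum_i M_i (x) mu_i with a POVM M and states mu_i.

Only C^2 (x) C^n, n <= 3, needs work. By Krein-Milman it is enough to show that every extreme ray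
X = [[A, B], [B*, C]] of the PPT cone is a product. A Hermitian H with ker X <= ker H and
ker X^T <= ker H^T (^T the partial transpose) may be added to X and subtracted from it in small
multiples, hence is a multiple of X. This reduces X to C = 1, where X and X^T are positive iff
D1 = A - BB* and D2 = A - B*B are. If D2 (or D1) has rank at least 2, counting real parameters yields
an H of trace zero, which is impossible, or a product vector that can be subtracted. Otherwise D1 = xx*
and D2 = yy*, and B is the corner of a normal matrix [[B, x], [y*, z]] after a change of the phase of y;
an eigenvector of it yields a product vector that can be subtracted. That the phase exists comes down,
for n = 3 and a unit vector e orthogonal to x and y, to |<e, By>| = |<e, B*x>|, which follows from
[B, B*] = yy* - xx*.
*)
theory Submission
  imports Defs
begin

subsection \<open>Adjoints and positive semidefinite matrices\<close>

text \<open>With \<open>C = 1\<close>, \<open>D1 = x x*\<close> and \<open>D2 = y y*\<close>, the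
  block matrix is \<open>Y Y*\<close> for \<open>Y\<close> with block rows \<open>B, x\<close> and
  \<open>1, 0\<close>. Its range consists of the pairs \<open>(B v + t x, v)\<close>, and that of
  the partial transpose of the pairs \<open>(adj B v + s y, v)\<close>. A product block can be
  subtracted once \<open>(z v, v)\<close> and \<open>(cnj z v, v)\<close> lie in these ranges, that
  is, once \<open>B v + t x = z v\<close> and \<open>adj B v + s y = cnj z v\<close>. A common
  eigenvector of the bordered matrix and its adjoint yields both equations at once, which is why
  that matrix has to be normal. \<open>D1\<close> and \<open>D2\<close> fix \<open>x\<close> and
  \<open>y\<close> only up to phases, hence the freedom of phase. The bound \<open>n <= 3\<close>
  enters through two lines: the kernel of \<open>D2\<close> is at most a line when its rank is at
  least 2, and the orthogonal complement of independent \<open>x\<close>, \<open>y\<close> is at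
  most a line, so that a single phase is enough. Existence of the maxima is shown for the operators
  \<open>X\<close>, which form a compact set. The one-way values, with their unbounded number of
  outcomes, inherit it because the two sets of values coincide.\<close>

definition adj :: "complex^'n^'m \<Rightarrow> complex^'m^'n" where
  "adj M = map_matrix cnj (transpose M)"

definition cdot :: "complex^'n \<Rightarrow> complex^'n \<Rightarrow> complex" where
  "cdot u v = (\<Sum>i\<in>UNIV. cnj (u $ i) * v $ i)"

definition outer :: "complex^'m \<Rightarrow> complex^'n \<Rightarrow> complex^'n^'m" where
  "outer v w = (\<chi> i j. v $ i * cnj (w $ j))"

lemma adj_nth [simp]: "adj M $ i $ j = cnj (M $ j $ i)"
  by (simp add: adj_def map_matrix_def transpose_def)

lemma outer_nth [simp]: "outer v w $ i $ j = v $ i * cnj (w $ j)"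
  by (simp add: outer_def)

lemma hermitian_iff: "hermitian X \<longleftrightarrow> adj X = X"
  by (simp add: hermitian_def adj_def)

lemma adj_adj [simp]: "adj (adj M) = M"
  by (simp add: vec_eq_iff)

lemma adj_add: "adj (M + N) = adj M + adj N"
  by (simp add: vec_eq_iff)

lemma adj_diff: "adj (M - N) = adj M - adj N"
  by (simp add: vec_eq_iff)

lemma adj_scaleR: "adj (r *\<^sub>R M) = r *\<^sub>R adj M"
  by (simp add: vec_eq_iff)

lemma adj_zero [simp]: "adj 0 = 0"
  by (simp add: vec_eq_iff)

lemma adj_mat_1 [simp]: "adj (mat 1) = mat 1"
  by (simp add: vec_eq_iff mat_def)

lemma adj_mult: "adj (M ** N) = adj N ** adj M"
  by (simp add: vec_eq_iff matrix_matrix_mult_def mult.commute)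

lemma adj_outer [simp]: "adj (outer v w) = outer w v"
  by (simp add: vec_eq_iff mult.commute)

lemma cdot_add_left: "cdot (u + v) w = cdot u w + cdot v w"
  by (simp add: cdot_def distrib_right sum.distrib)

lemma cdot_add_right: "cdot w (u + v) = cdot w u + cdot w v"
  by (simp add: cdot_def distrib_left sum.distrib)

lemma cdot_diff_left: "cdot (u - v) w = cdot u w - cdot v w"
  by (simp add: cdot_def left_diff_distrib sum_subtractf)

lemma cdot_diff_right: "cdot w (u - v) = cdot w u - cdot w v"
  by (simp add: cdot_def right_diff_distrib sum_subtractf)

lemma cdot_scale_left: "cdot (c *s u) w = cnj c * cdot u w"
  by (simp add: cdot_def sum_distrib_left mult.assoc)

lemma cdot_scale_right: "cdot w (c *s u) = c * cdot w u"
  by (simp add: cdot_def sum_distrib_left mult.left_commute)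

lemma cdot_zero [simp]: "cdot 0 u = 0" "cdot u 0 = 0"
  by (simp_all add: cdot_def)

lemma cdot_minus: "cdot (- u) w = - cdot u w" "cdot u (- w) = - cdot u w"
  by (simp_all add: cdot_def sum_negf)

lemma cnj_cdot: "cnj (cdot u v) = cdot v u"
  by (simp add: cdot_def mult.commute)

lemma Re_cdot: "Re (cdot u v) = u \<bullet> v"
  by (simp add: cdot_def inner_vec_def inner_complex_def)

lemma cdot_self: "cdot u u = complex_of_real (norm u ^ 2)"
proof (rule complex_eqI)
  show "Re (cdot u u) = Re (complex_of_real (norm u ^ 2))"
    by (simp add: Re_cdot power2_norm_eq_inner)
  have "cnj (cdot u u) = cdot u u"
    by (rule cnj_cdot)
  then show "Im (cdot u u) = Im (complex_of_real (norm u ^ 2))"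
    by (metis Im_complex_of_real Reals_cnj_iff complex_is_Real_iff)
qed

lemma cdot_self_eq_0 [simp]: "cdot u u = 0 \<longleftrightarrow> u = 0"
  by (simp add: cdot_self)

lemma cdot_adj: "cdot u (M *v v) = cdot (adj M *v u) v"
  unfolding cdot_def matrix_vector_mult_def
  by (simp add: sum_distrib_left sum_distrib_right mult_ac) (rule sum.swap)

lemma cdot_adj': "cdot (M *v u) v = cdot u (adj M *v v)"
  by (simp add: cdot_adj)

lemma inner_adj: "u \<bullet> (M *v v) = (adj M *v u) \<bullet> v"
  by (metis Re_cdot cdot_adj)

lemma cdot_axis: "cdot (axis k 1) v = v $ k" "cdot v (axis k 1) = cnj (v $ k)"
  by (simp_all add: cdot_def axis_def if_distrib if_distribR cong: if_cong)

lemma outer_mult_vec: "outer x y *v u = cdot y u *s x"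
  by (simp add: vec_eq_iff matrix_vector_mult_def cdot_def sum_distrib_left mult_ac)

lemma scaleR_vec_eq: "r *\<^sub>R (v :: complex^'n) = complex_of_real r *s v"
  by (simp add: vec_eq_iff scaleR_conv_of_real[where 'a=complex])

lemma scaleR_matrix_vec: "(r *\<^sub>R (M :: complex^'n^'m)) *v v = r *\<^sub>R (M *v v)"
  by (simp add: vec_eq_iff matrix_vector_mult_def scaleR_sum_right)

lemma matrix_vec_scaleR: "(M :: complex^'n^'m) *v (r *\<^sub>R v) = r *\<^sub>R (M *v v)"
  by (simp add: vec_eq_iff matrix_vector_mult_def scaleR_sum_right)

lemma matrix_vec_scale: "(M :: complex^'n^'m) *v (c *s v) = c *s (M *v v)"
  by (simp add: vec_eq_iff matrix_vector_mult_def sum_distrib_left mult_ac)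

section \<open>Quadratic forms of self-adjoint operators\<close>

lemma psd_iff: "psd X \<longleftrightarrow> adj X = X \<and> (\<forall>v. 0 \<le> v \<bullet> (X *v v))"
  unfolding psd_def hermitian_iff by (simp add: cdot_def[symmetric] Re_cdot)

lemma linear_matrix_vec: "linear (\<lambda>v. (M :: complex^'n^'m) *v v)"
  by (rule linearI) (simp_all add: matrix_vector_right_distrib matrix_vec_scaleR)

text \<open>Along \<open>v + s w\<close> with \<open>w = T v\<close> the form is
  \<open>2 s n + s^2 q\<close>, which is negative for small negative \<open>s\<close>. The setting
  of a real inner product space with an invariant subspace covers matrices, block operators and
  \<open>m - T\<close> on a subspace alike.\<close>

lemma psd_form_zero:
  fixes T :: "'e::real_inner \<Rightarrow> 'e"
  assumes lin: "linear T" and E: "subspace E" and inv: "\<And>x. x \<in> E \<Longrightarrow> T x \<in> E"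
    and sa: "\<And>x y. x \<in> E \<Longrightarrow> y \<in> E \<Longrightarrow> x \<bullet> T y = T x \<bullet> y"
    and pos: "\<And>x. x \<in> E \<Longrightarrow> 0 \<le> x \<bullet> T x"
    and v: "v \<in> E" "v \<bullet> T v = 0"
  shows "T v = 0"
proof (rule ccontr)
  assume "T v \<noteq> 0"
  define w where "w = T v"
  define n where "n = w \<bullet> w"
  define q where "q = w \<bullet> T w"
  have n: "n > 0" using \<open>T v \<noteq> 0\<close> by (simp add: n_def w_def)
  have wE: "w \<in> E" using inv v by (simp add: w_def)
  have q: "q \<ge> 0" using pos wE by (simp add: q_def)
  \<comment> \<open>The denominator \<open>1 + q\<close> instead of \<open>q\<close> also serves the
    case \<open>q = 0\<close>.\<close>
  define s where "s = - n / (1 + q)"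
  have mem: "v + s *\<^sub>R w \<in> E" using E v wE by (simp add: subspace_add subspace_scale)
  have "v \<bullet> T w = n" using sa[OF v(1) wE] by (simp add: n_def w_def)
  then have "(v + s *\<^sub>R w) \<bullet> T (v + s *\<^sub>R w) = 2 * s * n + s^2 * q"
    using v(2) by (simp add: linear_add[OF lin] linear_scale[OF lin] inner_add_left inner_add_right
        n_def q_def power2_eq_square inner_commute algebra_simps flip: w_def)
  also have "\<dots> = - (s^2 * (2 + q))"
  proof -
    have "n = - s * (1 + q)" using q by (simp add: s_def)
    then have "2 * s * n = 2 * s * (- s * (1 + q))" by simp
    then show ?thesis by (simp add: algebra_simps power2_eq_square)
  qed
  also have "\<dots> < 0"
    using n q by (auto simp: s_def)
  finally show False using pos[OF mem] by simp
qed

text \<open>On the orthogonal complement of the kernel of \<open>T\<close> the form of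
  \<open>T\<close> is at least \<open>d |x|^2\<close> by compactness of the unit sphere, and that of
  \<open>H\<close> is at most \<open>B |x|^2\<close> in modulus. The kernel component contributes to
  neither form, so \<open>t = d / B\<close> works.\<close>

lemma psd_perturb:
  fixes T H :: "'e::euclidean_space \<Rightarrow> 'e"
  assumes lin: "linear T" "linear H"
    and sa: "\<And>x y. x \<bullet> T y = T x \<bullet> y" "\<And>x y. x \<bullet> H y = H x \<bullet> y"
    and pos: "\<And>x. 0 \<le> x \<bullet> T x"
    and ker: "\<And>x. T x = 0 \<Longrightarrow> H x = 0"
  shows "\<exists>t>0. \<forall>x. t * \<bar>x \<bullet> H x\<bar> \<le> x \<bullet> T x"
proof -
  define K where "K = {x. T x = 0}"
  have K: "subspace K" unfolding K_def by (rule linear_subspace_kernel[OF lin(1)])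
  define P where "P = {y. \<forall>x\<in>K. orthogonal x y}"
  have P: "subspace P" unfolding P_def by (rule subspace_orthogonal_to_vectors)
  obtain B where B: "B > 0" "\<And>x. norm (H x) \<le> B * norm x"
    using linear_bounded_pos[OF lin(2)] by blast
  have "\<exists>d>0. \<forall>x\<in>P. d * norm x ^ 2 \<le> x \<bullet> T x"
  proof (cases "P \<inter> sphere 0 1 = {}")
    case True
    have "x = 0" if "x \<in> P" for x
    proof (rule ccontr)
      assume "x \<noteq> 0"
      then have "inverse (norm x) *\<^sub>R x \<in> P \<inter> sphere 0 1"
        using that P by (simp add: subspace_scale)
      with True show False by blast
    qed
    then show ?thesis by (intro exI[of _ 1]) (metis inner_zero_left mult_1 norm_zero order_refl power_zero_numeral zero_less_one)
  next
    case False
    have c: "compact (P \<inter> sphere 0 1)"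
      using closed_subspace[OF P] by (simp add: closed_Int_compact)
    have "continuous_on (P \<inter> sphere 0 1) (\<lambda>x. x \<bullet> T x)"
      by (intro continuous_intros linear_continuous_on linear_conv_bounded_linear[THEN iffD1] lin)
    from continuous_attains_inf[OF c False this]
    obtain z where z: "z \<in> P" "norm z = 1" "\<And>y. y \<in> P \<Longrightarrow> norm y = 1 \<Longrightarrow> z \<bullet> T z \<le> y \<bullet> T y"
      by auto
    have "z \<bullet> T z \<noteq> 0"
    proof
      assume "z \<bullet> T z = 0"
      then have "T z = 0"
        using psd_form_zero[of T UNIV z] lin sa pos by auto
      then have "z \<in> K" by (simp add: K_def)
      with z(1) have "orthogonal z z" by (simp add: P_def)
      with z(2) show False by (auto simp: orthogonal_self)
    qed
    then have pos': "z \<bullet> T z > 0" using pos[of z] by simp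
    have "(z \<bullet> T z) * norm x ^ 2 \<le> x \<bullet> T x" if "x \<in> P" for x
    proof (cases "x = 0")
      case False
      define y where "y = inverse (norm x) *\<^sub>R x"
      have "y \<in> P" "norm y = 1" using that P False by (simp_all add: y_def subspace_scale)
      then have "z \<bullet> T z \<le> y \<bullet> T y" by (rule z)
      moreover have "y \<bullet> T y * norm x ^ 2 = x \<bullet> T x"
        using False by (simp add: y_def linear_scale[OF lin(1)] power2_eq_square field_simps)
      ultimately show ?thesis by (metis mult_right_mono zero_le_power2)
    qed (simp add: lin linear_0)
    with pos' show ?thesis by blast
  qed
  then obtain d where d: "d > 0" "\<And>x. x \<in> P \<Longrightarrow> d * norm x ^ 2 \<le> x \<bullet> T x" by blast
  have main: "(d / B) * \<bar>x \<bullet> H x\<bar> \<le> x \<bullet> T x" for x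
  proof -
    obtain k p where kp: "k \<in> span K" "\<And>w. w \<in> span K \<Longrightarrow> orthogonal p w" "x = k + p"
      using orthogonal_subspace_decomp_exists[of K x] by blast
    have k: "T k = 0" "H k = 0" using kp(1) K ker by (auto simp: K_def span_eq_iff[THEN iffD2])
    have p: "p \<in> P" using kp(2) by (auto simp: P_def span_base orthogonal_commute)
    have T: "x \<bullet> T x = p \<bullet> T p"
      using k sa(1)[of k p] by (simp add: kp(3) linear_add[OF lin(1)] inner_add_left)
    have H: "x \<bullet> H x = p \<bullet> H p"
      using k sa(2)[of k p] by (simp add: kp(3) linear_add[OF lin(2)] inner_add_left)
    have "\<bar>p \<bullet> H p\<bar> \<le> norm p * norm (H p)" by (rule Cauchy_Schwarz_ineq2)
    also have "\<dots> \<le> norm p * (B * norm p)" by (intro mult_left_mono B) auto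
    also have "\<dots> = B * norm p ^ 2" by (simp add: power2_eq_square)
    finally have "(d / B) * \<bar>p \<bullet> H p\<bar> \<le> (d / B) * (B * norm p ^ 2)"
      using d(1) B(1) by (intro mult_left_mono) auto
    also have "\<dots> = d * norm p ^ 2" using B(1) by simp
    finally show ?thesis using d(2)[OF p] by (simp add: T H)
  qed
  show ?thesis
    using main d(1) B(1) by (intro exI[of _ "d / B"]) auto
qed

text \<open>A maximiser \<open>z\<close> of the form on the unit sphere of \<open>E\<close>, with
  maximum \<open>m\<close>, makes the form of \<open>m - T\<close> nonnegative on \<open>E\<close>
  with a zero at \<open>z\<close>. The subspace \<open>E\<close> is there to find common
  eigenvectors of two commuting operators.\<close>

lemma selfadjoint_eigenvector:
  fixes T :: "'e::euclidean_space \<Rightarrow> 'e"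
  assumes lin: "linear T" and E: "subspace E" and ne: "w \<in> E" "w \<noteq> 0"
    and inv: "\<And>x. x \<in> E \<Longrightarrow> T x \<in> E"
    and sa: "\<And>x y. x \<in> E \<Longrightarrow> y \<in> E \<Longrightarrow> x \<bullet> T y = T x \<bullet> y"
  shows "\<exists>v\<in>E. v \<noteq> 0 \<and> (\<exists>m. T v = m *\<^sub>R v)"
proof -
  have c: "compact (E \<inter> sphere 0 1)"
    using closed_subspace[OF E] by (simp add: closed_Int_compact)
  have ne': "E \<inter> sphere 0 1 \<noteq> {}"
  proof -
    have "inverse (norm w) *\<^sub>R w \<in> E \<inter> sphere 0 1"
      using ne E by (simp add: subspace_scale)
    then show ?thesis by blast
  qed
  have "continuous_on (E \<inter> sphere 0 1) (\<lambda>x. x \<bullet> T x)"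
    by (intro continuous_intros linear_continuous_on linear_conv_bounded_linear[THEN iffD1] lin)
  from continuous_attains_sup[OF c ne' this]
  obtain z where z: "z \<in> E" "norm z = 1" "\<And>y. y \<in> E \<Longrightarrow> norm y = 1 \<Longrightarrow> y \<bullet> T y \<le> z \<bullet> T z"
    by auto
  define m where "m = z \<bullet> T z"
  define F where "F x = m *\<^sub>R x - T x" for x
  have "F z = 0"
  proof (rule psd_form_zero[of F E z])
    show "linear F"
      unfolding F_def by (rule linearI) (simp_all add: linear_add[OF lin] linear_scale[OF lin] algebra_simps)
    show "subspace E" "z \<in> E" by fact+
    show "F x \<in> E" if "x \<in> E" for x
      using that E inv by (simp add: F_def subspace_diff subspace_scale)
    show "x \<bullet> F y = F x \<bullet> y" if "x \<in> E" "y \<in> E" for x y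
      using sa[OF that] by (simp add: F_def inner_diff_left inner_diff_right)
    show "z \<bullet> F z = 0"
      using z(2) by (simp add: F_def inner_diff_right m_def flip: power2_norm_eq_inner)
    show "0 \<le> x \<bullet> F x" if "x \<in> E" for x
    proof (cases "x = 0")
      case False
      define y where "y = inverse (norm x) *\<^sub>R x"
      have "y \<in> E" "norm y = 1" using that E False by (simp_all add: y_def subspace_scale)
      then have "y \<bullet> T y \<le> m" unfolding m_def by (rule z)
      moreover have "y \<bullet> T y * norm x ^ 2 = x \<bullet> T x"
        using False by (simp add: y_def linear_scale[OF lin(1)] power2_eq_square field_simps)
      ultimately have "x \<bullet> T x \<le> m * norm x ^ 2" by (metis mult_right_mono zero_le_power2)
      then show ?thesis by (simp add: F_def inner_diff_right power2_norm_eq_inner)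
    qed simp
  qed
  then have "T z = m *\<^sub>R z" by (simp add: F_def)
  moreover have "z \<noteq> 0" using z(2) by auto
  ultimately show ?thesis using z(1) by blast
qed

text \<open>\<open>N + adj N\<close> and \<open>i (N - adj N)\<close> are commuting self-adjoint
  operators: the second leaves an eigenspace of the first invariant and has an eigenvector in
  it.\<close>

lemma normal_eigenvector:
  fixes N :: "complex^'n^'n"
  assumes normal: "N ** adj N = adj N ** N"
  shows "\<exists>z v. v \<noteq> 0 \<and> N *v v = z *s v \<and> adj N *v v = cnj z *s v"
proof -
  define H where "H = N + adj N"
  define K where "K v = \<i> *s (N *v v - adj N *v v)" for v
  have linH: "linear (\<lambda>v. H *v v)" by (rule linear_matrix_vec)
  have linK: "linear K"
    unfolding K_def
    by (rule linearI) (simp_all add: matrix_vector_right_distrib matrix_vec_scaleR vec_eq_iff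
        algebra_simps scaleR_conv_of_real[where 'a=complex])
  have "\<exists>v\<in>UNIV. v \<noteq> 0 \<and> (\<exists>m. H *v v = m *\<^sub>R v)"
  proof (rule selfadjoint_eigenvector[OF linH])
    show "(axis undefined 1 :: complex^'n) \<noteq> 0" by (simp add: axis_eq_0_iff)
    show "x \<bullet> (H *v y) = (H *v x) \<bullet> y" for x y
      by (simp add: inner_adj H_def adj_add add.commute)
  qed auto
  then obtain l w where w: "w \<noteq> 0" "H *v w = l *\<^sub>R w" by blast
  define E where "E = {v. H *v v = l *\<^sub>R v}"
  have comm: "N *v (adj N *v v) = adj N *v (N *v v)" for v
    using normal by (simp add: matrix_vector_mul_assoc)
  have "\<exists>v\<in>E. v \<noteq> 0 \<and> (\<exists>m. K v = m *\<^sub>R v)"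
  proof (rule selfadjoint_eigenvector[OF linK])
    show "subspace E"
      unfolding E_def
      by (auto intro!: subspaceI simp: matrix_vector_right_distrib matrix_vec_scaleR algebra_simps)
    show "w \<in> E" "w \<noteq> 0" using w by (simp_all add: E_def)
    show "x \<bullet> K y = K x \<bullet> y" for x y
    proof -
      have "cdot x (K y) = cdot (K x) y"
        by (simp add: K_def cdot_scale_left cdot_scale_right cdot_diff_left cdot_diff_right
            cdot_adj algebra_simps)
      then show ?thesis by (metis Re_cdot)
    qed
    show "K x \<in> E" if "x \<in> E" for x
    proof -
      have "H *v (K x) = K (H *v x)"
        by (simp add: K_def H_def matrix_vec_scale matrix_vector_right_distrib
            matrix_vector_mult_add_rdistrib matrix_vector_mult_diff_distrib comm)
      also have "\<dots> = l *\<^sub>R K x"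
        using that by (simp add: E_def linear_scale[OF linK])
      finally show ?thesis by (simp add: E_def)
    qed
  qed
  then obtain m v where v: "v \<noteq> 0" "H *v v = l *\<^sub>R v" "K v = m *\<^sub>R v"
    by (auto simp: E_def)
  have 1: "(N *v v) $ i + (adj N *v v) $ i = of_real l * v $ i" for i
    using v(2) by (simp add: H_def vec_eq_iff matrix_vector_mult_add_rdistrib scaleR_conv_of_real[where 'a=complex])
  have 2: "\<i> * ((N *v v) $ i - (adj N *v v) $ i) = of_real m * v $ i" for i
    using v(3) by (simp add: K_def vec_eq_iff scaleR_conv_of_real[where 'a=complex] right_diff_distrib)
  have 2: "(N *v v) $ i - (adj N *v v) $ i = - \<i> * of_real m * v $ i" for i
    using 2[of i] by (metis (no_types, lifting) i_squared mult.assoc mult_minus_left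
        mult_minus1 minus_minus mult.commute)
  \<comment> \<open>This is \<open>N = (H - i K) / 2\<close> at the eigenvalues \<open>l\<close> of
    \<open>H\<close> and \<open>m\<close> of \<open>K\<close>.\<close>
  define z where "z = (of_real l - \<i> * of_real m) / 2"
  have "2 * (N *v v) $ i = (of_real l - \<i> * of_real m) * v $ i"
    "2 * (adj N *v v) $ i = (of_real l + \<i> * of_real m) * v $ i" for i
    using 1[of i] 2[of i] by algebra+
  then have "N *v v = z *s v" "adj N *v v = cnj z *s v"
    by (simp_all add: vec_eq_iff z_def field_simps)
  with v(1) show ?thesis by blast
qed

section \<open>Kernels and factorisations of positive semidefinite matrices\<close>

lemma psd_cdot_real:
  assumes "adj X = X"
  shows "cdot v (X *v v) = complex_of_real (v \<bullet> (X *v v))"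
proof -
  have "cnj (cdot v (X *v v)) = cdot v (X *v v)"
    by (simp add: cnj_cdot cdot_adj assms)
  then show ?thesis by (metis Re_cdot Reals_cnj_iff complex_is_Real_iff of_real_Re)
qed

lemma psd_kernel:
  assumes "psd X" "v \<bullet> (X *v v) = 0"
  shows "X *v v = 0"
  by (rule psd_form_zero[of "\<lambda>v. X *v v" UNIV])
    (use assms in \<open>auto simp: psd_iff linear_matrix_vec inner_adj\<close>)

lemma psd_outer: "psd (outer v v)"
proof -
  have "u \<bullet> (outer v v *v u) = norm (cdot v u) ^ 2" for u
  proof -
    have "cdot u (outer v v *v u) = cnj (cdot v u) * cdot v u"
      by (simp add: outer_mult_vec cdot_scale_right cnj_cdot mult.commute)
    also have "\<dots> = complex_of_real (norm (cdot v u) ^ 2)"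
      by (metis complex_norm_square mult.commute of_real_power)
    finally show ?thesis by (metis Re_cdot Re_complex_of_real)
  qed
  then show ?thesis by (simp add: psd_iff)
qed

lemma psd_add: "psd X \<Longrightarrow> psd Y \<Longrightarrow> psd (X + Y)"
  by (simp add: psd_iff adj_add matrix_vector_mult_add_rdistrib inner_add_right)

lemma psd_zero: "psd 0"
  by (simp add: psd_iff)

lemma psd_scaleR: "psd X \<Longrightarrow> 0 \<le> r \<Longrightarrow> psd (r *\<^sub>R X)"
  by (simp add: psd_iff adj_scaleR scaleR_matrix_vec)

lemma psd_sum: "(\<And>i. i \<in> I \<Longrightarrow> psd (f i)) \<Longrightarrow> psd (\<Sum>i\<in>I. f i)"
  by (induction I rule: infinite_finite_induct) (auto simp: psd_add psd_zero)

lemma psd_mult_adj: "psd (W ** adj W)"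
proof -
  have "v \<bullet> ((W ** adj W) *v v) = (adj W *v v) \<bullet> (adj W *v v)" for v
    by (simp add: inner_adj[of v W] flip: matrix_vector_mul_assoc)
  then show ?thesis by (simp add: psd_iff adj_mult)
qed

text \<open>One step of Cholesky elimination: \<open>outer w w\<close> is the largest multiple of
  \<open>outer (X f) (X f)\<close> that leaves a positive remainder. The step adds \<open>f\<close>
  to the kernel and keeps what was there.\<close>

lemma psd_subtract_outer:
  assumes X: "psd X" and f: "f \<bullet> (X *v f) \<noteq> 0"
  defines "w \<equiv> (1 / sqrt (f \<bullet> (X *v f))) *\<^sub>R (X *v f)"
  shows "psd (X - outer w w)" "(X - outer w w) *v f = 0"
    "\<And>u. X *v u = 0 \<Longrightarrow> (X - outer w w) *v u = 0" "w \<noteq> 0"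
    "\<And>u. X *v u = 0 \<Longrightarrow> cdot w u = 0" "cdot w f \<noteq> 0"
proof -
  have adj: "adj X = X" and pos: "\<And>v. 0 \<le> v \<bullet> (X *v v)" using X by (auto simp: psd_iff)
  define a where "a = f \<bullet> (X *v f)"
  have a: "a > 0" using f pos[of f] by (simp add: a_def)
  have wdef: "w = complex_of_real (1 / sqrt a) *s (X *v f)"
    by (simp add: w_def a_def scaleR_vec_eq)
  have wu: "cdot w u = complex_of_real (1 / sqrt a) * cdot f (X *v u)" for u
    by (simp add: wdef cdot_scale_left cdot_adj adj)
  have ff: "cdot f (X *v f) = complex_of_real a"
    by (simp add: psd_cdot_real adj a_def)
  show ku: "cdot w u = 0" if "X *v u = 0" for u
    by (simp add: wu that)
  show "(X - outer w w) *v u = 0" if "X *v u = 0" for u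
    by (simp add: matrix_vector_mult_diff_rdistrib outer_mult_vec ku that)
  have sq: "complex_of_real (sqrt a) * complex_of_real (sqrt a) = complex_of_real a"
    using a by (metis of_real_mult real_sqrt_mult_self abs_of_pos)
  have wf: "cdot w f = complex_of_real (sqrt a)"
    using a sq by (simp add: wu ff field_simps)
  then show "cdot w f \<noteq> 0" using a by simp
  then show "w \<noteq> 0" by auto
  show kf: "(X - outer w w) *v f = 0"
  proof -
    have "(X - outer w w) *v f = X *v f - complex_of_real (sqrt a) *s w"
      by (simp add: matrix_vector_mult_diff_rdistrib outer_mult_vec wf)
    also have "\<dots> = 0" using a by (simp add: wdef vec_eq_iff)
    finally show ?thesis .
  qed
  have "0 \<le> v \<bullet> ((X - outer w w) *v v)" for v
  proof -
    \<comment> \<open>Splitting \<open>v = u + s f\<close> with \<open>u\<close> orthogonal to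
      \<open>w\<close>: the remainder kills \<open>f\<close> and agrees with \<open>X\<close> on
      \<open>u\<close>.\<close>
    define s where "s = cdot w v / complex_of_real (sqrt a)"
    define u where "u = v - s *s f"
    have wu0: "cdot w u = 0" using a by (simp add: u_def cdot_diff_right cdot_scale_right wf s_def)
    have "v = u + s *s f" by (simp add: u_def)
    then have "(X - outer w w) *v v = (X - outer w w) *v u"
      by (simp add: matrix_vector_right_distrib matrix_vec_scale kf)
    also have "\<dots> = X *v u"
      by (simp add: matrix_vector_mult_diff_rdistrib outer_mult_vec wu0)
    finally have e: "(X - outer w w) *v v = X *v u" .
    have "cdot f (X *v u) = 0" using wu0 a by (simp add: wu)
    then have "cdot v (X *v u) = cdot u (X *v u)"
      using \<open>v = u + s *s f\<close> by (metis add.right_neutral cdot_add_left cdot_scale_left mult_zero_right)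
    then have "v \<bullet> (X *v u) = u \<bullet> (X *v u)" by (metis Re_cdot)
    then show ?thesis using e pos by simp
  qed
  then show "psd (X - outer w w)" by (simp add: psd_iff adj_diff adj)
qed

lemma sum_outer: "(\<Sum>k\<in>UNIV. outer (w k) (w k)) = (\<chi> i k. w k $ i) ** adj (\<chi> i k. w k $ i)"
  by (simp add: vec_eq_iff matrix_matrix_mult_def)

lemma matrix_vec_axis: "((M :: complex^'n^'m) *v axis j 1) $ i = M $ i $ j"
  by (simp add: matrix_vector_mult_def axis_def if_distrib cong: if_cong)

text \<open>Elimination with the coordinate vectors one after another; once all of them lie in the
  kernel of the remainder, it is zero. The columns of \<open>W\<close> are the vectors split
  off.\<close>

lemma psd_factor:
  fixes X :: "complex^'n^'n"
  assumes "psd X"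
  shows "\<exists>W :: complex^'n^'n. X = W ** adj W"
proof -
  have "\<exists>w. psd (X - (\<Sum>k\<in>I. outer (w k) (w k))) \<and>
      (\<forall>k\<in>I. (X - (\<Sum>k\<in>I. outer (w k) (w k))) *v axis k 1 = 0)" if "finite I" for I :: "'n set"
    using that
  proof (induction I)
    case empty
    then show ?case using assms by simp
  next
    case (insert k I)
    then obtain w where w: "psd (X - (\<Sum>k\<in>I. outer (w k) (w k)))"
      "\<And>j. j \<in> I \<Longrightarrow> (X - (\<Sum>k\<in>I. outer (w k) (w k))) *v axis j 1 = 0" by blast
    define Y where "Y = X - (\<Sum>k\<in>I. outer (w k) (w k))"
    have "\<exists>v. psd (Y - outer v v) \<and> (\<forall>j\<in>insert k I. (Y - outer v v) *v axis j 1 = 0)"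
    proof (cases "axis k 1 \<bullet> (Y *v axis k 1) = 0")
      case True
      have Y: "psd Y" using w by (simp add: Y_def)
      moreover have "outer 0 0 = (0 :: complex^'n^'n)" by (simp add: vec_eq_iff)
      ultimately show ?thesis
        using w(2) psd_kernel[OF Y True] by (intro exI[of _ 0]) (auto simp: Y_def)
    next
      case False
      have Y: "psd Y" using w by (simp add: Y_def)
      from psd_subtract_outer[OF Y False] w(2) show ?thesis
        unfolding Y_def[symmetric] by (metis insert_iff)
    qed
    then obtain v where v: "psd (Y - outer v v)" "\<And>j. j \<in> insert k I \<Longrightarrow> (Y - outer v v) *v axis j 1 = 0"
      by blast
    have "(\<Sum>j\<in>insert k I. outer ((w(k := v)) j) ((w(k := v)) j)) =
        outer v v + (\<Sum>k\<in>I. outer (w k) (w k))"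
      using insert.hyps by (auto intro!: sum.cong)
    then have "X - (\<Sum>j\<in>insert k I. outer ((w(k := v)) j) ((w(k := v)) j)) = Y - outer v v"
      by (simp add: Y_def algebra_simps)
    with v show ?case by (intro exI[of _ "w(k := v)"]) simp
  qed
  from this[OF finite_class.finite_UNIV] obtain w :: "'n \<Rightarrow> complex^'n" where
    w: "\<forall>k\<in>UNIV. (X - (\<Sum>k\<in>UNIV. outer (w k) (w k))) *v axis k 1 = 0" by blast
  have "(X - (\<Sum>k\<in>UNIV. outer (w k) (w k))) $ i $ j = 0" for i j
    using arg_cong[OF bspec[OF w UNIV_I, of j], of "\<lambda>v. v $ i"]
    by (simp only: matrix_vec_axis zero_index)
  then have "X = (\<Sum>k\<in>UNIV. outer (w k) (w k))" by (simp add: vec_eq_iff)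
  then show ?thesis unfolding sum_outer by blast
qed

subsection \<open>Rays of the PPT cone on two by n systems\<close>

text \<open>
  The triple \<open>(A, B, C)\<close> stands for the Hermitian block matrix with rows \<open>A, B\<close> and \<open>B\<^sup>*, C\<close>. Its partial
  transpose on the first factor swaps the off-diagonal blocks; it has the same positivity as the
  transpose on the second factor, being its complex conjugate.
\<close>

type_synonym 'n blocks = "'n cmat \<times> 'n cmat \<times> 'n cmat"

definition block_op :: "'n::finite blocks \<Rightarrow> (complex^'n) \<times> (complex^'n) \<Rightarrow> (complex^'n) \<times> (complex^'n)" where
  "block_op T = (\<lambda>(u, v). case T of (A, B, C) \<Rightarrow> (A *v u + B *v v, adj B *v u + C *v v))"

definition flip :: "'n::finite blocks \<Rightarrow> 'n blocks" where
  "flip T = (case T of (A, B, C) \<Rightarrow> (A, adj B, C))"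

definition block_herm :: "'n::finite blocks \<Rightarrow> bool" where
  "block_herm T \<longleftrightarrow> (case T of (A, B, C) \<Rightarrow> adj A = A \<and> adj C = C)"

definition block_psd :: "'n::finite blocks \<Rightarrow> bool" where
  "block_psd T \<longleftrightarrow> block_herm T \<and> (\<forall>z. 0 \<le> z \<bullet> block_op T z)"

definition ppt :: "'n::finite blocks \<Rightarrow> bool" where
  "ppt T \<longleftrightarrow> block_psd T \<and> block_psd (flip T)"

definition block_tr :: "'n::finite blocks \<Rightarrow> real" where
  "block_tr T = (case T of (A, B, C) \<Rightarrow> Re (trace A) + Re (trace C))"

text \<open>An extreme ray of the cone, in order form and without normalisation of \<open>T\<close>.
  The sign of \<open>t\<close> is left open; where it matters it is recovered from traces.\<close>

definition ray :: "'n::finite blocks \<Rightarrow> bool" where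
  "ray T \<longleftrightarrow> ppt T \<and> T \<noteq> 0 \<and> (\<forall>Y. ppt Y \<longrightarrow> ppt (T - Y) \<longrightarrow> (\<exists>t. Y = t *\<^sub>R T))"

text \<open>The rank-one block matrix of the product vector \<open>(a, b) (x) v\<close>. As
  \<open>flip\<close> only conjugates \<open>a\<close> and \<open>b\<close>, it belongs to the PPT
  cone.\<close>

definition product_block :: "complex \<Rightarrow> complex \<Rightarrow> complex^'n \<Rightarrow> 'n::finite blocks" where
  "product_block a b v = (outer (a *s v) (a *s v), outer (a *s v) (b *s v), outer (b *s v) (b *s v))"

definition product_blocks :: "'n::finite blocks set" where
  "product_blocks = {product_block a b v | a b v. True}"

lemma block_op_add: "block_op (S + T) z = block_op S z + block_op T z"
  by (simp add: block_op_def split: prod.splits)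
    (auto simp: matrix_vector_mult_add_rdistrib adj_add)

lemma block_op_scaleR: "block_op (r *\<^sub>R T) z = r *\<^sub>R block_op T z"
  by (simp add: block_op_def split: prod.splits)
    (auto simp: scaleR_matrix_vec adj_scaleR scaleR_add_right)

lemma linear_block_op: "linear (block_op T)"
  by (rule linearI)
    (auto simp: block_op_def matrix_vector_right_distrib matrix_vec_scaleR scaleR_add_right
      split: prod.splits)

lemma block_op_selfadj:
  assumes "block_herm T"
  shows "x \<bullet> block_op T y = block_op T x \<bullet> y"
  using assms
  by (auto simp: block_op_def block_herm_def inner_adj inner_add_left inner_add_right split: prod.splits)

lemma flip_add: "flip (S + T) = flip S + flip T"
  and flip_diff: "flip (S - T) = flip S - flip T"
  and flip_scaleR: "flip (r *\<^sub>R T) = r *\<^sub>R flip T"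
  and flip_flip [simp]: "flip (flip T) = T"
  and flip_0 [simp]: "flip 0 = 0"
  by (auto simp: flip_def adj_add adj_diff adj_scaleR zero_prod_def split: prod.splits)

lemma block_herm_add: "block_herm S \<Longrightarrow> block_herm T \<Longrightarrow> block_herm (S + T)"
  and block_herm_diff: "block_herm S \<Longrightarrow> block_herm T \<Longrightarrow> block_herm (S - T)"
  and block_herm_scaleR: "block_herm T \<Longrightarrow> block_herm (r *\<^sub>R T)"
  and block_herm_flip [simp]: "block_herm (flip T) = block_herm T"
  by (auto simp: flip_def block_herm_def adj_add adj_diff adj_scaleR split: prod.splits)

lemma block_psd_add: "block_psd S \<Longrightarrow> block_psd T \<Longrightarrow> block_psd (S + T)"
  by (simp add: block_psd_def block_herm_add block_op_add inner_add_right)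

lemma block_psd_scaleR: "block_psd T \<Longrightarrow> 0 \<le> r \<Longrightarrow> block_psd (r *\<^sub>R T)"
  by (simp add: block_psd_def block_herm_scaleR block_op_scaleR)

lemma ppt_add: "ppt S \<Longrightarrow> ppt T \<Longrightarrow> ppt (S + T)"
  by (simp add: ppt_def flip_add block_psd_add)

lemma ppt_scaleR: "ppt T \<Longrightarrow> 0 \<le> r \<Longrightarrow> ppt (r *\<^sub>R T)"
  by (simp add: ppt_def flip_scaleR block_psd_scaleR)

lemma ppt_flip [simp]: "ppt (flip T) = ppt T"
  by (auto simp: ppt_def)

lemma linear_block_tr: "linear block_tr"
proof (rule linearI)
  show "block_tr (S + T) = block_tr S + block_tr T" for S T :: "'a blocks"
    by (simp add: block_tr_def trace_def sum.distrib split: prod.splits)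
  show "block_tr (r *\<^sub>R T) = r *\<^sub>R block_tr T" for r and T :: "'a blocks"
    by (simp add: block_tr_def trace_def sum_distrib_left distrib_left split: prod.splits)
qed

lemma block_perturb:
  assumes T: "block_psd T" and H: "block_herm H"
    and ker: "\<And>z. block_op T z = 0 \<Longrightarrow> block_op H z = 0"
  shows "\<exists>t>0. \<forall>s. \<bar>s\<bar> \<le> t \<longrightarrow> block_psd (T + s *\<^sub>R H)"
proof -
  have "\<exists>t>0. \<forall>x. t * \<bar>x \<bullet> block_op H x\<bar> \<le> x \<bullet> block_op T x"
    using assms by (intro psd_perturb) (auto simp: linear_block_op block_op_selfadj block_psd_def)
  then obtain t where t: "t > 0" "\<And>x. t * \<bar>x \<bullet> block_op H x\<bar> \<le> x \<bullet> block_op T x" by blast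
  have "block_psd (T + s *\<^sub>R H)" if s: "\<bar>s\<bar> \<le> t" for s
  proof -
    have "0 \<le> x \<bullet> block_op (T + s *\<^sub>R H) x" for x
    proof -
      have "\<bar>s * (x \<bullet> block_op H x)\<bar> \<le> t * \<bar>x \<bullet> block_op H x\<bar>"
        using s by (simp add: abs_mult mult_right_mono)
      with t(2)[of x] show ?thesis by (simp add: block_op_add block_op_scaleR inner_add_right)
    qed
    then show ?thesis using T H by (simp add: block_psd_def block_herm_add block_herm_scaleR)
  qed
  with t show ?thesis by blast
qed

lemma ray_perturb:
  assumes T: "ray T" and H: "block_herm H"
    and ker: "\<And>z. block_op T z = 0 \<Longrightarrow> block_op H z = 0"
      "\<And>z. block_op (flip T) z = 0 \<Longrightarrow> block_op (flip H) z = 0"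
  shows "\<exists>s. H = s *\<^sub>R T"
proof -
  have ppt: "ppt T" using T by (simp add: ray_def)
  obtain t1 where t1: "t1 > 0" "\<And>s. \<bar>s\<bar> \<le> t1 \<Longrightarrow> block_psd (T + s *\<^sub>R H)"
    using block_perturb[of T H] ppt H ker(1) unfolding ppt_def by blast
  obtain t2 where t2: "t2 > 0" "\<And>s. \<bar>s\<bar> \<le> t2 \<Longrightarrow> block_psd (flip T + s *\<^sub>R flip H)"
    using block_perturb[of "flip T" "flip H"] ppt H ker(2) unfolding ppt_def block_herm_flip by blast
  define t where "t = min t1 t2"
  have t: "t > 0" using t1 t2 by (simp add: t_def)
  have p: "ppt (T + s *\<^sub>R H)" if "\<bar>s\<bar> \<le> t" for s
    using that t1(2)[of s] t2(2)[of s] by (simp add: ppt_def flip_add flip_scaleR t_def)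
  define Y where "Y = (1/2) *\<^sub>R (T + t *\<^sub>R H)"
  have Y: "ppt Y" using t by (simp add: Y_def ppt_scaleR p)
  have "Y + (1/2) *\<^sub>R (T + (- t) *\<^sub>R H) = (1/2) *\<^sub>R ((T + t *\<^sub>R H) + (T + (- t) *\<^sub>R H))"
    by (simp only: scaleR_add_right Y_def)
  also have "(T + t *\<^sub>R H) + (T + (- t) *\<^sub>R H) = 2 *\<^sub>R T" by (simp only: scaleR_2 scaleR_minus_left) simp
  also have "(1/2) *\<^sub>R 2 *\<^sub>R T = T" by simp
  finally have "Y + (1/2) *\<^sub>R (T + (- t) *\<^sub>R H) = T" .
  then have "T - Y = (1/2) *\<^sub>R (T + (- t) *\<^sub>R H)" by (metis add_diff_cancel_left')
  then have "ppt (T - Y)" using ppt_scaleR[OF p[of "- t"], of "1/2"] t by (simp only: abs_minus_cancel)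
  then obtain r where r: "Y = r *\<^sub>R T" using Y T unfolding ray_def by blast
  have "T + t *\<^sub>R H = 2 *\<^sub>R Y" by (simp only: Y_def scaleR_scaleR) simp
  also have "\<dots> = (2 * r) *\<^sub>R T" by (simp add: r)
  finally have "t *\<^sub>R H = (2 * r) *\<^sub>R T - T" by (metis add_diff_cancel_left')
  then have "t *\<^sub>R H = (2 * r - 1) *\<^sub>R T" by (simp only: scaleR_left_diff_distrib scaleR_one)
  then have "(1 / t) *\<^sub>R (t *\<^sub>R H) = (1 / t) *\<^sub>R ((2 * r - 1) *\<^sub>R T)" by (rule arg_cong)
  moreover have "1 / t * t = 1" using t by simp
  ultimately have "H = (1 / t * (2 * r - 1)) *\<^sub>R T"
    by (simp only: scaleR_scaleR scaleR_one)
  then show ?thesis by (rule exI)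
qed

subsection \<open>Rank two self-commutators in dimension three\<close>

text \<open>
  Below, \<open>m\<close>, \<open>c\<close>, \<open>r\<close> are the entries of the matrix with rows \<open>m11 m12 c1\<close>, \<open>m21 m22 c2\<close> and \<open>r1 r2 0\<close>, and
  \<open>n\<close>, \<open>d\<close>, \<open>s\<close> their conjugates, kept as independent variables so that the claims are ideal
  memberships. The two conclusions determine \<open>|c \<cdot> x|\<close> and \<open>|r \<cdot> x|\<close> up to order in terms of \<open>y\<close>.
\<close>

lemma commutator_quadratic_identity:
  fixes m11 m12 m21 m22 n11 n12 n21 n22 c1 c2 d1 d2 :: complex
  shows "(m11*c1 + m12*c2) * (n11*d1 + n12*d2) + (m21*c1 + m22*c2) * (n21*d1 + n22*d2)
      + (n11*c1 + n21*c2) * (m11*d1 + m21*d2) + (n12*c1 + n22*c2) * (m12*d1 + m22*d2)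
    = (n11+n22) * (d1*(m11*c1 + m12*c2) + d2*(m21*c1 + m22*c2))
      + (m11+m22) * (d1*(n11*c1 + n21*c2) + d2*(n12*c1 + n22*c2))
      + (m11*n11 + m12*n12 + m21*n21 + m22*n22 - (m11+m22)*(n11+n22)) * (d1*c1 + d2*c2)"
  by algebra

lemma commutator_coordinates:
  fixes m11 m12 m21 m22 n11 n12 n21 n22 c1 c2 d1 d2 r1 r2 s1 s2 x1 x1' y1 y1' y2 y2' :: complex
  assumes E11: "n21*m21 + s1 * r1 - m12*n12 - c1*d1 = x1*x1' - y1*y1'"
    and E12: "n11*m12 + n21*m22 + s1 * r2 - m11*n21 - m12*n22 - c1*d2 = - (y1*y2')"
    and E21: "n12*m11 + n22*m21 + s2 * r1 - m21*n11 - m22*n12 - c2*d1 = - (y2*y1')"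
    and E22: "n12*m12 + s2 * r2 - m21*n21 - c2*d2 = - (y2*y2')"
    and E13: "n11*c1 + n21*c2 = m11 * s1 + m12 * s2"
    and E23: "n12*c1 + n22*c2 = m21 * s1 + m22 * s2"
    and E31: "m11*d1 + m21*d2 = n11*r1 + n12*r2"
    and E32: "m12*d1 + m22*d2 = n21*r1 + n22*r2"
    and E33: "s1 * r1 + s2 * r2 = c1*d1 + c2*d2"
  shows "c1*r1*x1*x1' = (c1*y1' + c2*y2') * (r1*y1 + r2*y2)"
    and "r1 * s1 * x1 * x1' + c1*d1*x1*x1' =
      (r1*y1 + r2*y2) * (s1*y1' + s2*y2') + (d1*y1 + d2*y2) * (c1*y1' + c2*y2')"
proof -
  \<comment> \<open>Let \<open>N\<close> be the 3 by 3 matrix and \<open>M\<close> its block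
    \<open>m\<close>. The difference of the outer products of \<open>x\<close> and \<open>y\<close>
    is a commutator of \<open>N\<close> and its adjoint, hence trace-orthogonal to \<open>1\<close>,
    \<open>N\<close> and \<open>N^2\<close>, which gives the three equations. Cayley-Hamilton for
    \<open>M\<close> then removes \<open>M^2\<close> from the third and leaves the rank-one form
    \<open>c r\<close>.\<close>
  have "x1*x1' = y1*y1' + y2*y2'"
    using E11 E22 E33 by algebra
  moreover have "m11*x1*x1' = m11*y1'*y1 + m12*y1'*y2 + m21*y2'*y1 + m22*y2'*y2"
    using E11 E12 E21 E22 E13 E23 E31 E32 by algebra
  moreover have "(c1*r1 + m11*m11 + m12*m21)*x1*x1' =
      (c1*r1 + m11*m11 + m12*m21)*y1'*y1 + (c1*r2 + m11*m12 + m12*m22)*y1'*y2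
      + (c2*r1 + m21*m11 + m22*m21)*y2'*y1 + (c2*r2 + m21*m12 + m22*m22)*y2'*y2"
    using E11 E12 E21 E22 E13 E23 E31 E32 E33 by algebra
  ultimately show "c1*r1*x1*x1' = (c1*y1' + c2*y2') * (r1*y1 + r2*y2)"
    by algebra
  \<comment> \<open>The forms of \<open>M\<close> and of its adjoint take the same values at
    \<open>c\<close> and at the adjoint of \<open>r\<close>.\<close>
  have k1: "d1*(m11*c1 + m12*c2) + d2*(m21*c1 + m22*c2) =
      r1*(m11 * s1 + m12 * s2) + r2*(m21 * s1 + m22 * s2)"
    using E13 E23 E31 E32 by algebra
  have k2: "d1*(n11*c1 + n21*c2) + d2*(n12*c1 + n22*c2) =
      r1*(n11 * s1 + n21 * s2) + r2*(n12 * s1 + n22 * s2)"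
    using E13 E23 E31 E32 by algebra
  have h1: "(m11 * s1 + m12 * s2) * (n11*r1 + n12*r2) + (m21 * s1 + m22 * s2) * (n21*r1 + n22*r2) =
      (n11*c1 + n21*c2) * (m11*d1 + m21*d2) + (n12*c1 + n22*c2) * (m12*d1 + m22*d2)"
    unfolding E13 E23 E31 E32 ..
  \<comment> \<open>\<open>commutator_quadratic_identity\<close> is the polarised Cayley-Hamilton
    identity \<open>M L + L M = tr M L + tr L M + (tr (M L) - tr M tr L)\<close> for 2 by 2
    matrices, with \<open>L = adj M\<close>, evaluated as a form at \<open>c\<close>. At
    \<open>c\<close> and at the adjoint of \<open>r\<close> its right-hand sides agree by
    \<open>k1\<close>, \<open>k2\<close> and \<open>E33\<close>.\<close>
  have h2: "(m11*c1 + m12*c2) * (n11*d1 + n12*d2) + (m21*c1 + m22*c2) * (n21*d1 + n22*d2) =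
      (n11 * s1 + n21 * s2) * (m11*r1 + m21*r2) + (n12 * s1 + n22 * s2) * (m12*r1 + m22*r2)"
    using commutator_quadratic_identity[of m11 c1 m12 c2 n11 d1 n12 d2 m21 m22 n21 n22]
      commutator_quadratic_identity[of m11 s1 m12 s2 n11 r1 n12 r2 m21 m22 n21 n22] k1 k2 h1 E33
    by algebra
  show "r1 * s1 * x1 * x1' + c1*d1*x1*x1' =
      (r1*y1 + r2*y2) * (s1*y1' + s2*y2') + (d1*y1 + d2*y2) * (c1*y1' + c2*y2')"
    using E11 E12 E21 E22 h1 h2 E33 by algebra
qed

text \<open>The two pairs of moduli have equal products and equal sums of squares, so they agree up
  to order. In the unwanted order, if no modulus vanishes, the phases make \<open>c\<close> parallel
  to the adjoint of \<open>r\<close>, and as both have the same norm all moduli coincide; if one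
  vanishes, then \<open>c\<close> and \<open>r\<close> are zero.\<close>

lemma commutator_corner_norm:
  fixes m11 m12 m21 m22 c1 c2 r1 r2 x1 y1 y2 :: complex
  assumes x1: "x1 \<noteq> 0" and y2: "y2 \<noteq> 0"
    and E11: "cnj m21*m21 + cnj r1*r1 - m12*cnj m12 - c1*cnj c1 = x1*cnj x1 - y1*cnj y1"
    and E12: "cnj m11*m12 + cnj m21*m22 + cnj r1*r2 - m11*cnj m21 - m12*cnj m22 - c1*cnj c2 = - (y1*cnj y2)"
    and E22: "cnj m12*m12 + cnj r2*r2 - m21*cnj m21 - c2*cnj c2 = - (y2*cnj y2)"
    and E13: "cnj m11*c1 + cnj m21*c2 = m11*cnj r1 + m12*cnj r2"
    and E23: "cnj m12*c1 + cnj m22*c2 = m21*cnj r1 + m22*cnj r2"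
    and E33: "cnj r1*r1 + cnj r2*r2 = c1*cnj c1 + c2*cnj c2"
  shows "cmod (cnj c1 * x1) = cmod (r1*y1 + r2*y2)"
proof -
  have E21: "cnj m12*m11 + cnj m22*m21 + cnj r2*r1 - m21*cnj m11 - m22*cnj m12 - c2*cnj c1 = - (y2*cnj y1)"
    using arg_cong[OF E12, of cnj] by (simp add: algebra_simps)
  have E31: "m11*cnj c1 + m21*cnj c2 = cnj m11*r1 + cnj m12*r2"
    using arg_cong[OF E13, of cnj] by (simp add: algebra_simps)
  have E32: "m12*cnj c1 + m22*cnj c2 = cnj m21*r1 + cnj m22*r2"
    using arg_cong[OF E23, of cnj] by (simp add: algebra_simps)
  note C = commutator_coordinates[OF E11 E12 E21 E22 E13 E23 E31 E32 E33]
  define a where "a = cmod (c1 * x1)"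
  define b where "b = cmod (r1 * x1)"
  define a' where "a' = cmod (c1 * cnj y1 + c2 * cnj y2)"
  define b' where "b' = cmod (r1*y1 + r2*y2)"
  have nonneg: "0 \<le> a" "0 \<le> b" "0 \<le> a'" "0 \<le> b'"
    by (simp_all add: a_def b_def a'_def b'_def)
  have prod: "a * b = a' * b'"
  proof -
    have "cmod (c1*r1*x1*cnj x1) = cmod (c1 * x1) * cmod (r1 * x1)"
      by (simp add: norm_mult)
    then show ?thesis
      using arg_cong[OF C(1), of cmod] by (simp add: a_def b_def a'_def b'_def norm_mult mult_ac)
  qed
  have sq: "complex_of_real (cmod z ^ 2) = z * cnj z" for z
    by (metis complex_norm_square of_real_power)
  have "complex_of_real (b^2 + a^2) = complex_of_real (b'^2 + a'^2)"
  proof -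
    have "complex_of_real (b^2 + a^2) = r1*cnj r1*x1*cnj x1 + c1*cnj c1*x1*cnj x1"
      unfolding of_real_add a_def b_def sq by (simp add: mult_ac)
    also have "\<dots> = complex_of_real (b'^2 + a'^2)"
      unfolding C(2) of_real_add a'_def b'_def sq by (simp add: mult_ac)
    finally show ?thesis .
  qed
  then have sum: "b^2 + a^2 = b'^2 + a'^2" by (simp only: of_real_eq_iff)
  have "(a^2 - b'^2) * (a^2 - a'^2) = 0"
    using sum prod by algebra
  then have "a^2 = b'^2 \<or> a^2 = a'^2" by auto
  then have "a = b'"
  proof
    assume "a^2 = b'^2"
    then show ?thesis using nonneg by (simp add: power2_eq_iff_nonneg)
  next
    assume "a^2 = a'^2"
    then have eq: "a = a'" "b = b'" using nonneg sum by (simp_all add: power2_eq_iff_nonneg)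
    consider "a = 0" | "b = 0" | "a \<noteq> 0" "b \<noteq> 0" by blast
    then show ?thesis
    proof cases
      case 1
      then have "c1 = 0" using x1 by (simp add: a_def)
      moreover have "c2 = 0" using 1 eq y2 \<open>c1 = 0\<close> by (simp add: a'_def)
      ultimately have "complex_of_real (cmod r1 ^ 2 + cmod r2 ^ 2) = 0"
        using E33 unfolding of_real_add sq by (simp add: mult.commute)
      then have "r1 = 0" "r2 = 0" by (simp_all only: of_real_eq_0_iff sum_power2_eq_zero_iff norm_eq_zero)
      then show ?thesis using 1 by (simp add: b'_def)
    next
      case 2
      then have "r1 = 0" using x1 by (simp add: b_def)
      moreover have "r2 = 0" using 2 eq y2 \<open>r1 = 0\<close> by (simp add: b'_def)
      ultimately have "complex_of_real (cmod c1 ^ 2 + cmod c2 ^ 2) = 0"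
        using E33 unfolding of_real_add sq by (simp add: mult.commute)
      then have "c1 = 0" "c2 = 0" by (simp_all only: of_real_eq_0_iff sum_power2_eq_zero_iff norm_eq_zero)
      then show ?thesis using 2 eq by (simp add: a_def)
    next
      case 3
      have nz: "r1 \<noteq> 0" "c1 \<noteq> 0" using 3 by (auto simp: a_def b_def)
      have "(r1*x1) * cnj (r1*x1) = (r1*y1 + r2*y2) * cnj (r1*y1 + r2*y2)"
        using eq(2) unfolding sq[symmetric] by (simp add: b_def b'_def)
      with C(1) have "(r1*x1*cnj x1) * (c1 * (cnj r1*cnj y1 + cnj r2*cnj y2)) =
          (r1*x1*cnj x1) * (cnj r1 * (c1*cnj y1 + c2*cnj y2))"
        unfolding complex_cnj_add complex_cnj_mult by algebra
      then have "c1 * (cnj r1*cnj y1 + cnj r2*cnj y2) = cnj r1 * (c1*cnj y1 + c2*cnj y2)"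
        using nz x1 by simp
      then have "cnj y2 * (c1 * cnj r2) = cnj y2 * (cnj r1 * c2)" by algebra
      then have k: "c1 * cnj r2 = cnj r1 * c2" using y2 by simp
      have k': "cnj c1 * r2 = r1 * cnj c2" using arg_cong[OF k, of cnj] by simp
      have "(cnj r1 * r1 - c1 * cnj c1) * (c1*cnj c1 + c2*cnj c2) = 0"
        using k k' E33 by algebra
      moreover have "c1*cnj c1 + c2*cnj c2 \<noteq> 0"
      proof
        assume "c1*cnj c1 + c2*cnj c2 = 0"
        then have "complex_of_real (cmod c1 ^ 2 + cmod c2 ^ 2) = 0" unfolding of_real_add sq .
        then have "c1 = 0" by (simp only: of_real_eq_0_iff sum_power2_eq_zero_iff norm_eq_zero)
        with nz show False by simp
      qed
      ultimately have "r1 * cnj r1 = c1 * cnj c1" by (simp add: mult.commute)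
      then have "cmod r1 ^ 2 = cmod c1 ^ 2" unfolding sq[symmetric] by (simp only: of_real_eq_iff)
      then have "cmod r1 = cmod c1" by (simp add: power2_eq_iff_nonneg)
      then show ?thesis using eq by (simp add: a_def b_def norm_mult)
    qed
  qed
  then show ?thesis by (simp add: a_def b'_def norm_mult)
qed

section \<open>Orthogonal vectors in dimension at most three\<close>

lemma not_in_span_orthogonal:
  assumes "u \<noteq> 0" "\<And>v. v \<in> S \<Longrightarrow> cdot u v = 0"
  shows "u \<notin> vec.span S"
proof
  assume "u \<in> vec.span S"
  moreover have "vec.span S \<subseteq> {v. cdot u v = 0}"
    by (rule vec.span_minimal) (auto simp: assms vec.subspace_def cdot_add_right cdot_scale_right)
  ultimately have "cdot u u = 0" by auto
  with assms(1) show False by simp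
qed

lemma orthogonal_independent_3:
  fixes e f g :: "complex^'n"
  assumes "e \<noteq> 0" "f \<noteq> 0" "g \<noteq> 0" and "cdot f e = 0" "cdot g e = 0" "cdot g f = 0"
  shows "vec.independent {g, f, e}" "card {g, f, e} = 3"
proof -
  have f: "f \<notin> vec.span {e}" and g: "g \<notin> vec.span {f, e}"
    by (rule not_in_span_orthogonal; use assms in auto)+
  have neq: "f \<notin> {e}" "g \<notin> {f, e}"
    using f g vec.span_base by metis+
  then show "card {g, f, e} = 3" by simp
  have "vec.independent {}" by (rule vec.independent_empty)
  then have "vec.independent {e}"
    using assms by (simp only: vec.independent_insert vec.span_empty) simp
  then have "vec.independent {f, e}"
    by (simp only: vec.independent_insert neq f if_False) simp
  then show "vec.independent {g, f, e}"
    by (simp only: vec.independent_insert neq g if_False) simp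
qed

lemma independent_card_le:
  fixes S :: "(complex^'n) set"
  assumes "vec.independent S"
  shows "card S \<le> CARD('n)"
  using vec.dim_eq_card_independent[OF assms] dim_subset_UNIV_cart_gen[of S] by simp

lemma orthogonal_3_card:
  fixes e f g :: "complex^'n"
  assumes "e \<noteq> 0" "f \<noteq> 0" "g \<noteq> 0" and "cdot f e = 0" "cdot g e = 0" "cdot g f = 0"
  shows "3 \<le> CARD('n)"
  using independent_card_le[OF orthogonal_independent_3(1)[OF assms]]
  by (simp only: orthogonal_independent_3(2)[OF assms])

lemma orthogonal_card_le_3:
  fixes e f g u :: "complex^'n"
  assumes "CARD('n) \<le> 3" and nz: "e \<noteq> 0" "f \<noteq> 0" "g \<noteq> 0"
    and orth: "cdot f e = 0" "cdot g e = 0" "cdot g f = 0"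
    and "cdot u e = 0" "cdot u f = 0" "cdot u g = 0"
  shows "u = 0"
proof (rule ccontr)
  assume "u \<noteq> 0"
  then have u: "u \<notin> vec.span {g, f, e}"
    by (rule not_in_span_orthogonal) (use assms in auto)
  then have neq: "u \<notin> {g, f, e}" using vec.span_base by metis
  have "vec.independent {u, g, f, e}"
    using orthogonal_independent_3(1)[OF nz orth]
    by (simp only: vec.independent_insert neq u if_False) simp
  then have "card {u, g, f, e} \<le> CARD('n)" by (rule independent_card_le)
  moreover have "card {u, g, f, e} = Suc (card {g, f, e})" using neq by (intro card_insert_disjoint) auto
  ultimately show False using assms(1) by (simp only: orthogonal_independent_3(2)[OF nz orth])
qed

lemma trace_mult_outer: "trace (M ** outer x y) = cdot y (M *v x)"
  by (simp add: trace_def matrix_matrix_mult_def matrix_vector_mult_def cdot_def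
      sum_distrib_left sum_distrib_right mult_ac)

lemma trace_outer: "trace (outer x y) = cdot y x"
  using trace_mult_outer[of "mat 1" x y] by simp

lemma orthonormal_expansion:
  fixes e f g u :: "complex^'n"
  assumes "CARD('n) \<le> 3" and unit: "cdot e e = 1" "cdot f f = 1" "cdot g g = 1"
    and orth: "cdot e f = 0" "cdot e g = 0" "cdot f g = 0"
  shows "u = cdot e u *s e + cdot f u *s f + cdot g u *s g"
proof -
  have orth': "cdot f e = 0" "cdot g e = 0" "cdot g f = 0"
    using orth by (metis cnj_cdot complex_cnj_zero)+
  define w where "w = u - (cdot e u *s e + cdot f u *s f + cdot g u *s g)"
  have "cdot e w = 0" "cdot f w = 0" "cdot g w = 0"
    by (simp_all add: w_def cdot_diff_right cdot_add_right cdot_scale_right unit orth orth')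
  then have "cdot w e = 0" "cdot w f = 0" "cdot w g = 0"
    by (metis cnj_cdot complex_cnj_zero)+
  moreover have "e \<noteq> 0" "f \<noteq> 0" "g \<noteq> 0" using unit by auto
  ultimately have "w = 0"
    using orthogonal_card_le_3[OF assms(1), of e f g w] orth' by blast
  then show ?thesis by (simp add: w_def)
qed

lemma orthonormal_pair:
  assumes "x \<noteq> 0" and indep: "\<And>c. y \<noteq> c *s x"
  obtains f1 f2 a b c where "cdot f1 f1 = 1" "cdot f2 f2 = 1" "cdot f1 f2 = 0" "a \<noteq> 0" "c \<noteq> 0"
    "x = a *s f1" "y = b *s f1 + c *s f2"
proof -
  define n where "n = complex_of_real (norm x)"
  have n: "n \<noteq> 0" using assms by (simp add: n_def)
  have nn: "cdot x x = n * n" by (simp add: cdot_self n_def power2_eq_square)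
  define f1 where "f1 = (1 / n) *s x"
  have f11: "cdot f1 f1 = 1"
    using n by (simp add: f1_def cdot_scale_left cdot_scale_right nn n_def)
  have x: "x = n *s f1" using n by (simp add: f1_def)
  define b where "b = cdot f1 y"
  define w where "w = y - b *s f1"
  have w: "w \<noteq> 0" using indep[of "b * (1 / n)"] by (simp add: w_def f1_def)
  define m where "m = complex_of_real (norm w)"
  have m: "m \<noteq> 0" using w by (simp add: m_def)
  have mm: "cdot w w = m * m" by (simp add: cdot_self m_def power2_eq_square)
  define f2 where "f2 = (1 / m) *s w"
  have f22: "cdot f2 f2 = 1"
    using m by (simp add: f2_def cdot_scale_left cdot_scale_right mm m_def)
  have "cdot f1 w = 0" by (simp add: w_def cdot_diff_right cdot_scale_right f11 b_def)
  then have f12: "cdot f1 f2 = 0" by (simp add: f2_def cdot_scale_right)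
  have "m *s f2 = w" using m by (simp add: f2_def)
  then have y: "y = b *s f1 + m *s f2" by (simp add: w_def)
  show ?thesis by (rule that[OF f11 f22 f12 n m x y])
qed

text \<open>The commutator of \<open>B\<close> and \<open>adj B\<close> is trace-orthogonal to
  \<open>1\<close> and to \<open>B\<close>.\<close>

lemma commutator_traces:
  assumes S: "B ** adj B + outer x x = adj B ** B + outer y y"
  shows "cdot x x = cdot y y" "cdot x (B *v x) = cdot y (B *v y)"
proof -
  have "trace (B ** adj B) + trace (outer x x) = trace (adj B ** B) + trace (outer y y)"
    using arg_cong[OF S, of trace] by (simp add: trace_add)
  then show "cdot x x = cdot y y"
    by (simp add: trace_outer trace_mul_sym[of B "adj B"])
  have "trace (B ** (B ** adj B)) + trace (B ** outer x x) = trace (B ** (adj B ** B)) + trace (B ** outer y y)"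
    using arg_cong[OF S, of "\<lambda>M. trace (B ** M)"] by (simp add: trace_add matrix_add_ldistrib)
  moreover have "trace (B ** (adj B ** B)) = trace (B ** (B ** adj B))"
    by (subst (2) trace_mul_sym) (simp add: matrix_mul_assoc)
  ultimately show "cdot x (B *v x) = cdot y (B *v y)"
    by (simp add: trace_mult_outer)
qed

lemma commutator_corner:
  fixes B :: "complex^'n^'n"
  assumes card: "CARD('n) \<le> 3" and S: "B ** adj B + outer x x = adj B ** B + outer y y"
    and f: "cdot f1 f1 = 1" "cdot f2 f2 = 1" "cdot f1 f2 = 0" "a \<noteq> 0" "c \<noteq> 0"
    and x: "x = a *s f1" and y: "y = b *s f1 + c *s f2"
    and e: "cdot e e = 1" "cdot f1 e = 0" "cdot f2 e = 0"
  shows "cmod (cdot e (B *v y)) = cmod (cdot e (adj B *v x))"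
proof -
  have orth': "cdot e f1 = 0" "cdot e f2 = 0" "cdot f2 f1 = 0"
    using f e by (metis cnj_cdot complex_cnj_zero)+
  \<comment> \<open>Subtracting the scalar \<open>b0\<close> from \<open>B\<close> makes the corner
    entry vanish, as the computation in coordinates expects. It changes neither the commutator nor
    the two entries compared, since \<open>e\<close> is orthogonal to \<open>x\<close> and
    \<open>y\<close>.\<close>
  define b0 where "b0 = cdot e (B *v e)"
  define M where "M u = B *v u - b0 *s u" for u
  define M' where "M' u = adj B *v u - cnj b0 *s u" for u
  have ad: "cdot (M' u) v = cdot u (M v)" "cdot (M u) v = cdot u (M' v)" for u v
    by (simp_all add: M_def M'_def cdot_diff_left cdot_diff_right cdot_scale_left cdot_scale_right cdot_adj)
  have Sv: "M (M' u) + cdot x u *s x = M' (M u) + cdot y u *s y" for u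
  proof -
    have "B *v (adj B *v u) + cdot x u *s x = adj B *v (B *v u) + cdot y u *s y"
      using arg_cong[OF S, of "\<lambda>M. M *v u"]
      by (simp add: matrix_vector_mult_add_rdistrib outer_mult_vec flip: matrix_vector_mul_assoc)
    then show ?thesis
      by (simp add: M_def M'_def matrix_vector_mult_diff_distrib matrix_vec_scale algebra_simps vec_eq_iff)
  qed
  have exp: "cdot u v = cdot u f1 * cdot f1 v + cdot u f2 * cdot f2 v + cdot u e * cdot e v" for u v
    by (subst orthonormal_expansion[OF card f(1,2) e(1) f(3) e(2,3), of v])
      (simp add: cdot_add_right cdot_scale_right mult.commute)
  have ee: "cdot e (M e) = 0"
    by (simp add: M_def cdot_diff_right cdot_scale_right b0_def e)
  have SS: "cdot (M u) (M v) - cdot (M' u) (M' v) = cdot u x * cdot x v - cdot u y * cdot y v" for u v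
  proof -
    have "cdot u (M (M' v) + cdot x v *s x) = cdot u (M' (M v) + cdot y v *s y)" by (simp only: Sv)
    then show ?thesis
      by (simp add: cdot_add_right cdot_scale_right ad[symmetric] algebra_simps)
  qed
  define m11 m12 m21 m22 c1 c2 r1 r2 where mdef: "m11 = cdot f1 (M f1)" "m12 = cdot f1 (M f2)"
    "m21 = cdot f2 (M f1)" "m22 = cdot f2 (M f2)" "c1 = cdot f1 (M e)" "c2 = cdot f2 (M e)"
    "r1 = cdot e (M f1)" "r2 = cdot e (M f2)"
  have MM: "cdot (M u) (M v) = cnj (cdot f1 (M u)) * cdot f1 (M v) +
      cnj (cdot f2 (M u)) * cdot f2 (M v) + cnj (cdot e (M u)) * cdot e (M v)" for u v
    by (subst exp) (simp add: cnj_cdot)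
  have MM': "cdot (M' u) (M' v) = cdot u (M f1) * cnj (cdot v (M f1)) +
      cdot u (M f2) * cnj (cdot v (M f2)) + cdot u (M e) * cnj (cdot v (M e))" for u v
    by (subst exp) (simp add: cnj_cdot ad flip: ad(2))
  have px: "cdot f1 x = a" "cdot f2 x = 0" "cdot e x = 0" "cdot x f1 = cnj a" "cdot x f2 = 0" "cdot x e = 0"
    by (simp_all add: x cdot_scale_left cdot_scale_right f e orth')
  have py: "cdot f1 y = b" "cdot f2 y = c" "cdot e y = 0" "cdot y f1 = cnj b" "cdot y f2 = cnj c" "cdot y e = 0"
    by (simp_all add: y cdot_add_left cdot_add_right cdot_scale_left cdot_scale_right f e orth')
  note E = SS[unfolded MM MM']
  have "cmod (cnj c1 * a) = cmod (r1 * b + r2 * c)"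
  proof (rule commutator_corner_norm[of a c m21 r1 m12 c1 b m11 m22 r2 c2])
    show "a \<noteq> 0" "c \<noteq> 0" by fact+
    show "cnj m21*m21 + cnj r1*r1 - m12*cnj m12 - c1*cnj c1 = a*cnj a - b*cnj b"
      using E[of f1 f1] unfolding px py ee mdef[symmetric]
      by (simp add: algebra_simps)
    show "cnj m11*m12 + cnj m21*m22 + cnj r1*r2 - m11*cnj m21 - m12*cnj m22 - c1*cnj c2 = - (b*cnj c)"
      using E[of f1 f2] unfolding px py ee mdef[symmetric]
      by (simp add: algebra_simps)
    show "cnj m12*m12 + cnj r2*r2 - m21*cnj m21 - c2*cnj c2 = - (c*cnj c)"
      using E[of f2 f2] unfolding px py ee mdef[symmetric]
      by (simp add: algebra_simps)
    show "cnj m11*c1 + cnj m21*c2 = m11*cnj r1 + m12*cnj r2"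
      using E[of f1 e] unfolding px py ee mdef[symmetric]
      by (simp add: algebra_simps)
    show "cnj m12*c1 + cnj m22*c2 = m21*cnj r1 + m22*cnj r2"
      using E[of f2 e] unfolding px py ee mdef[symmetric]
      by (simp add: algebra_simps)
    show "cnj r1*r1 + cnj r2*r2 = c1*cnj c1 + c2*cnj c2"
      using E[of e e] unfolding px py ee mdef[symmetric]
      by (simp add: algebra_simps)
  qed
  moreover have "cnj c1 * a = cdot e (adj B *v x)"
  proof -
    have "cdot e (adj B *v x) = cdot e (M' x)"
      by (simp add: M'_def cdot_diff_right cdot_scale_right px)
    also have "\<dots> = cnj (cdot x (M e))" by (simp add: cnj_cdot ad)
    also have "\<dots> = cnj c1 * a" by (simp add: x cdot_scale_left mdef mult.commute)
    finally show ?thesis by simp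
  qed
  moreover have "r1 * b + r2 * c = cdot e (B *v y)"
  proof -
    have "cdot e (M y) = b * r1 + c * r2"
      unfolding mdef ad(2)[symmetric]
      by (simp add: mdef y cdot_add_right cdot_scale_right M_def matrix_vector_right_distrib
          matrix_vec_scale cdot_diff_right f e orth')
    then show ?thesis by (simp add: M_def cdot_diff_right cdot_scale_right py mult.commute)
  qed
  ultimately show ?thesis by simp
qed

text \<open>Strict Cauchy-Schwarz inequality: \<open>x\<close> and \<open>y\<close> are independent
  of equal norm, so for nonzero \<open>g\<close> the two terms have different moduli and cannot
  cancel.\<close>

lemma cdot_strict:
  assumes f: "cdot f1 f1 = 1" "cdot f2 f2 = 1" "cdot f1 f2 = 0"
    and "x = a *s f1" and "y = b *s f1 + c *s f2" and ac: "a \<noteq> 0" "c \<noteq> 0" and "cdot x x = cdot y y"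
    and g: "g * cdot x y + cnj g * cdot x x = 0"
  shows "g = 0"
proof (rule ccontr)
  assume "g \<noteq> 0"
  have orth: "cdot f2 f1 = 0" using f by (metis cnj_cdot complex_cnj_zero)
  have xx: "cdot x x = a * cnj a" and xy: "cdot x y = cnj a * b" and yy: "cdot y y = b * cnj b + c * cnj c"
    by (simp_all add: assms(4,5) cdot_add_left cdot_add_right cdot_scale_left cdot_scale_right f orth)
  have "cnj a * (g * b) = cnj a * (- (cnj g * a))" using g by (simp add: xx xy) algebra
  then have "g * b = - (cnj g * a)" by (simp only: mult_cancel_left complex_cnj_zero_iff ac) simp
  then have "cmod g * cmod b = cmod g * cmod a" by (metis complex_mod_cnj norm_minus_cancel norm_mult)
  then have "cmod a = cmod b" using \<open>g \<noteq> 0\<close> by simp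
  then have "a * cnj a = b * cnj b" by (simp only: complex_norm_square[symmetric])
  then have "c * cnj c = 0" using assms(8) by (simp add: xx yy)
  with ac show False by simp
qed

text \<open>
  Once \<open>B y - B\<^sup>* x\<close> lies in the span of \<open>x\<close> and \<open>y\<close>, the trace identities force its coefficients to be
  \<open>- cnj z\<close> and \<open>z\<close>; the phase \<open>t\<close> is what moves it into the span.
\<close>

lemma commutator_phase:
  fixes B :: "complex^'n^'n"
  assumes card: "CARD('n) \<le> 3" and S: "B ** adj B + outer x x = adj B ** B + outer y y"
    and x0: "x \<noteq> 0" and indep: "\<And>c. y \<noteq> c *s x"
  shows "\<exists>t z. cmod t = 1 \<and> B *v (t *s y) + cnj z *s x = adj B *v x + z *s (t *s y)"
proof -
  obtain f1 f2 a b c where f: "cdot f1 f1 = 1" "cdot f2 f2 = 1" "cdot f1 f2 = 0" and ac: "a \<noteq> 0" "c \<noteq> 0"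
    and x: "x = a *s f1" and y: "y = b *s f1 + c *s f2"
    using orthonormal_pair[OF x0 indep] by metis
  have "\<exists>t. cmod t = 1 \<and> (\<exists>p q. B *v (t *s y) - adj B *v x = p *s f1 + q *s f2)"
  proof (cases "\<exists>e. e \<noteq> 0 \<and> cdot f1 e = 0 \<and> cdot f2 e = 0")
    case False
    \<comment> \<open>Here \<open>f1\<close> and \<open>f2\<close> span the whole space, and the
      phase 1 will do.\<close>
    have "u = cdot f1 u *s f1 + cdot f2 u *s f2" for u
    proof -
      have f21: "cdot f2 f1 = 0" using f by (metis cnj_cdot complex_cnj_zero)
      define w where "w = u - (cdot f1 u *s f1 + cdot f2 u *s f2)"
      have "cdot f1 w = 0" "cdot f2 w = 0"
        by (simp_all add: w_def cdot_diff_right cdot_add_right cdot_scale_right f f21)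
      then have "w = 0" using False by blast
      then show ?thesis by (simp add: w_def)
    qed
    then have "\<exists>p q. B *v (1 *s y) - adj B *v x = p *s f1 + q *s f2" by blast
    then show ?thesis using norm_one by blast
  next
    case True
    then obtain e0 where e0: "e0 \<noteq> 0" "cdot f1 e0 = 0" "cdot f2 e0 = 0" by blast
    define n where "n = complex_of_real (norm e0)"
    define e where "e = (1 / n) *s e0"
    have n: "n \<noteq> 0" "cnj n = n" using e0 by (simp_all add: n_def)
    have "cdot e0 e0 = n * n" by (simp add: cdot_self n_def power2_eq_square)
    then have e: "cdot e e = 1" "cdot f1 e = 0" "cdot f2 e = 0"
      using n e0 by (simp_all add: e_def cdot_scale_left cdot_scale_right)
    have eq: "cmod (cdot e (B *v y)) = cmod (cdot e (adj B *v x))"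
      by (rule commutator_corner[OF card S f ac x y e])
    \<comment> \<open>Equal moduli provide a phase that cancels the component along
      \<open>e\<close>, the only direction outside the span of \<open>f1\<close> and
      \<open>f2\<close>.\<close>
    have "\<exists>t. cmod t = 1 \<and> t * cdot e (B *v y) = cdot e (adj B *v x)"
    proof (cases "cdot e (B *v y) = 0")
      case True
      then show ?thesis using eq by (intro exI[of _ 1]) simp
    next
      case False
      then show ?thesis using eq
        by (intro exI[of _ "cdot e (adj B *v x) / cdot e (B *v y)"]) (auto simp: norm_divide)
    qed
    then obtain t where t: "cmod t = 1" "t * cdot e (B *v y) = cdot e (adj B *v x)" by blast
    define w where "w = B *v (t *s y) - adj B *v x"
    have "cdot e w = 0" using t(2) by (simp add: w_def cdot_diff_right matrix_vec_scale cdot_scale_right)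
    then have "w = cdot f1 w *s f1 + cdot f2 w *s f2"
      using orthonormal_expansion[OF card f(1,2) e(1) f(3) e(2,3), of w] by simp
    then show ?thesis unfolding w_def using t(1) by blast
  qed
  then obtain t p q where t: "cmod t = 1" and pq: "B *v (t *s y) - adj B *v x = p *s f1 + q *s f2"
    by blast
  have tt: "t * cnj t = 1" "t \<noteq> 0" using t by (auto simp: complex_norm_square[symmetric])
  define Y where "Y = t *s y"
  define al where "al = q / (t * c)"
  define be where "be = (p - al * t * b) / a"
  have w: "B *v Y - adj B *v x = al *s Y + be *s x"
    using ac tt unfolding pq Y_def by (simp add: x y vec_eq_iff al_def be_def field_simps)
  have Sy: "outer Y Y = outer y y"
    using tt by (simp add: vec_eq_iff Y_def mult_ac)
  have tr: "cdot x x = cdot Y Y" "cdot x (B *v x) = cdot Y (B *v Y)"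
    using commutator_traces[of B x Y] S by (simp_all add: Sy)
  \<comment> \<open>The four terms cancel in pairs: two by moving \<open>B\<close> across the
    product, two by the second trace identity.\<close>
  have "cdot x (B *v Y - adj B *v x) + cnj (cdot Y (B *v Y - adj B *v x)) = 0"
  proof -
    have "cnj (cdot Y (adj B *v x)) = cdot x (B *v Y)" by (simp add: cnj_cdot cdot_adj)
    moreover have "cnj (cdot Y (B *v Y)) = cdot x (adj B *v x)"
      by (simp only: tr(2)[symmetric] cnj_cdot cdot_adj')
    ultimately show ?thesis by (simp add: cdot_diff_right)
  qed
  then have g: "(al + cnj be) * cdot x Y + cnj (al + cnj be) * cdot x x = 0"
    unfolding w by (simp add: cdot_add_right cdot_scale_right cnj_cdot tr(1)[symmetric] algebra_simps)
  have Y: "Y = (t * b) *s f1 + (t * c) *s f2" by (simp add: Y_def y vec_eq_iff algebra_simps)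
  have tc: "t * c \<noteq> 0" using tt ac by simp
  have "al + cnj be = 0"
    by (rule cdot_strict[OF f x Y ac(1) tc tr(1) g])
  then have "be = - cnj al"
  proof -
    assume "al + cnj be = 0"
    then have "cnj (al + cnj be) = 0" by simp
    then show ?thesis by (simp add: eq_neg_iff_add_eq_0 add.commute)
  qed
  moreover have "B *v Y = adj B *v x + (al *s Y + be *s x)"
    using w by (simp only: diff_eq_eq) (simp only: add.commute)
  ultimately have "B *v Y + cnj al *s x = adj B *v x + al *s Y"
    by (simp add: vec_eq_iff)
  with t show ?thesis unfolding Y_def by blast
qed

section \<open>Normal matrices bordered by one row and one column\<close>

lemma sum_option: "(\<Sum>i\<in>UNIV. f i) = f None + (\<Sum>i\<in>UNIV. f (Some i))" for f :: "'n::finite option \<Rightarrow> 'b::comm_monoid_add"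
  by (simp add: UNIV_option_conv sum.reindex)

definition border :: "complex^'n^'n \<Rightarrow> complex^'n \<Rightarrow> complex^'n \<Rightarrow> complex \<Rightarrow> complex^'n option^'n option" where
  "border B x y z = (\<chi> i j. case i of
     None \<Rightarrow> (case j of None \<Rightarrow> z | Some j \<Rightarrow> cnj (y $ j))
   | Some i \<Rightarrow> (case j of None \<Rightarrow> x $ i | Some j \<Rightarrow> B $ i $ j))"

lemma border_nth [simp]:
  "border B x y z $ Some i $ Some j = B $ i $ j" "border B x y z $ Some i $ None = x $ i"
  "border B x y z $ None $ Some j = cnj (y $ j)" "border B x y z $ None $ None = z"
  by (simp_all add: border_def)

text \<open>Blockwise, the large corner of the normality equation is \<open>S\<close>, the
  off-diagonal blocks are the equation \<open>z\<close> and its adjoint, and the scalar corner is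
  the equality of the norms of \<open>x\<close> and \<open>y\<close>, which is the trace of
  \<open>S\<close>.\<close>

lemma border_normal:
  assumes S: "B ** adj B + outer x x = adj B ** B + outer y y"
    and z: "B *v y + cnj z *s x = adj B *v x + z *s y"
  shows "border B x y z ** adj (border B x y z) = adj (border B x y z) ** border B x y z"
proof -
  let ?N = "border B x y z"
  have SS: "(?N ** adj ?N) $ Some i $ Some j = (adj ?N ** ?N) $ Some i $ Some j" for i j
  proof -
    have "(B ** adj B + outer x x) $ i $ j = (adj B ** B + outer y y) $ i $ j" by (simp only: S)
    then show ?thesis by (simp add: matrix_matrix_mult_def sum_option add.commute)
  qed
  have SN: "(?N ** adj ?N) $ Some i $ None = (adj ?N ** ?N) $ Some i $ None" for i
  proof -
    have "(B *v y + cnj z *s x) $ i = (adj B *v x + z *s y) $ i" by (simp only: z)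
    then show ?thesis by (simp add: matrix_matrix_mult_def matrix_vector_mult_def sum_option add.commute mult.commute)
  qed
  have NS: "(?N ** adj ?N) $ None $ Some i = (adj ?N ** ?N) $ None $ Some i" for i
  proof -
    have h: "adj (?N ** adj ?N) = ?N ** adj ?N" "adj (adj ?N ** ?N) = adj ?N ** ?N"
      by (simp_all add: adj_mult)
    have "adj (?N ** adj ?N) $ None $ Some i = adj (adj ?N ** ?N) $ None $ Some i"
      by (simp only: adj_nth SN)
    then show ?thesis by (simp only: h)
  qed
  have NN: "(?N ** adj ?N) $ None $ None = (adj ?N ** ?N) $ None $ None"
    using commutator_traces(1)[OF S]
    by (simp add: matrix_matrix_mult_def sum_option cdot_def mult.commute)
  show ?thesis
    unfolding vec_eq_iff by (intro allI, case_tac i; case_tac ia) (simp_all only: SS SN NS NN)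
qed

text \<open>\<open>v\<close> collects the old coordinates of an eigenvector of the bordered matrix,
  while \<open>t\<close> and, up to the phase, \<open>s\<close> are its extra coordinate. For
  \<open>x = 0\<close> also \<open>y = 0\<close>, and \<open>B\<close> itself is normal.\<close>

lemma range_vector:
  fixes B :: "complex^'n^'n"
  assumes card: "CARD('n) \<le> 3" and S: "B ** adj B + outer x x = adj B ** B + outer y y"
    and indep: "x = 0 \<or> (\<forall>c. y \<noteq> c *s x)"
  shows "\<exists>v z t s. v \<noteq> 0 \<and> B *v v + t *s x = z *s v \<and> adj B *v v + s *s y = cnj z *s v"
proof (cases "x = 0")
  case True
  then have "y = 0" using commutator_traces(1)[OF S] by (metis cdot_self_eq_0)
  moreover have "outer 0 0 = (0 :: complex^'n^'n)" by (simp add: vec_eq_iff)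
  ultimately have "B ** adj B = adj B ** B" using S True by simp
  then show ?thesis using normal_eigenvector[of B] True \<open>y = 0\<close> by auto
next
  case False
  then obtain t z where t: "cmod t = 1" and z: "B *v (t *s y) + cnj z *s x = adj B *v x + z *s (t *s y)"
    using commutator_phase[OF card S] indep by blast
  have tt: "t * cnj t = 1" using t by (simp add: complex_norm_square[symmetric])
  have "outer (t *s y) (t *s y) = outer y y"
    using tt by (simp add: vec_eq_iff mult_ac)
  then have S': "B ** adj B + outer x x = adj B ** B + outer (t *s y) (t *s y)" using S by simp
  obtain l V where V: "V \<noteq> 0" "border B x (t *s y) z *v V = l *s V"
    "adj (border B x (t *s y) z) *v V = cnj l *s V"
    using normal_eigenvector[OF border_normal[OF S' z]] by blast
  define v where "v = (\<chi> i. V $ Some i)"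
  have 1: "B *v v + V $ None *s x = l *s v"
  proof -
    have "(border B x (t *s y) z *v V) $ Some i = (l *s V) $ Some i" for i by (simp only: V)
    then show ?thesis
      by (simp add: vec_eq_iff matrix_vector_mult_def sum_option v_def mult.commute add.commute)
  qed
  have 2: "adj B *v v + (V $ None * t) *s y = cnj l *s v"
  proof -
    have "(adj (border B x (t *s y) z) *v V) $ Some i = (cnj l *s V) $ Some i" for i by (simp only: V)
    then show ?thesis
      by (simp add: vec_eq_iff matrix_vector_mult_def sum_option v_def mult_ac add.commute)
  qed
  have "v \<noteq> 0"
  proof
    assume v: "v = 0"
    then have "V $ None *s x = 0" using 1 by simp
    then have "V $ None = 0" using False by (auto simp: vec_eq_iff)
    moreover have "V $ Some i = 0" for i using arg_cong[OF v, of "\<lambda>v. v $ i"] by (simp add: v_def)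
    ultimately have "V = 0" by (simp add: vec_eq_iff split_option_all)
    with V show False by simp
  qed
  with 1 2 show ?thesis by blast
qed

lemma matrix_mult_scaleR_left: "(r *\<^sub>R (M :: complex^'n^'m)) ** N = r *\<^sub>R (M ** N)"
  by (simp add: vec_eq_iff matrix_matrix_mult_def scaleR_sum_right)

lemma matrix_mult_scaleR_right: "(M :: complex^'n^'m) ** (r *\<^sub>R N) = r *\<^sub>R (M ** N)"
  by (simp add: vec_eq_iff matrix_matrix_mult_def scaleR_sum_right)

lemma matrix_ext: "(\<And>v. M *v v = N *v v) \<Longrightarrow> M = N" for M N :: "complex^'n^'m"
  by (metis matrix_vec_axis vec_eq_iff)

lemma outer_self_eq_0: "outer v v = 0 \<longleftrightarrow> v = 0"
proof
  assume "outer v v = 0"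
  then have "trace (outer v v) = 0" by (simp add: trace_def)
  then show "v = 0" by (simp add: trace_outer)
qed (simp add: vec_eq_iff)

subsection \<open>Extreme rays are products\<close>

lemma block_op_axis:
  assumes "\<And>i. block_op T (axis i 1, 0) = 0" "\<And>i. block_op T (0, axis i 1) = 0"
  shows "T = 0"
proof -
  obtain A B C where T: "T = (A, B, C)" by (cases T)
  have "A *v axis i 1 = 0" "adj B *v axis i 1 = 0" "B *v axis i 1 = 0" "C *v axis i 1 = 0" for i
    using assms[of i] by (simp_all add: T block_op_def zero_prod_def)
  then have "A $ i $ j = 0" "B $ i $ j = 0" "C $ i $ j = 0" for i j
    by (metis matrix_vec_axis zero_index)+
  then show ?thesis by (simp add: T zero_prod_def vec_eq_iff)
qed

lemma block_tr_sum: "block_tr T =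
    (\<Sum>i\<in>UNIV. (axis i 1, 0) \<bullet> block_op T (axis i 1, 0)) + (\<Sum>i\<in>UNIV. (0, axis i 1) \<bullet> block_op T (0, axis i 1))"
proof -
  obtain A B C where T: "T = (A, B, C)" by (cases T)
  have "axis i 1 \<bullet> (M *v axis i 1) = Re (M $ i $ i)" for M :: "complex^'a^'a" and i
    by (metis Re_cdot cdot_axis(1) matrix_vec_axis)
  then show ?thesis by (simp add: T block_op_def block_tr_def trace_def)
qed

lemma block_psd_kernel: "block_psd T \<Longrightarrow> z \<bullet> block_op T z = 0 \<Longrightarrow> block_op T z = 0"
  by (rule psd_form_zero[of "block_op T" UNIV z])
    (auto simp: block_psd_def linear_block_op block_op_selfadj)

lemma block_tr_nonneg: "block_psd T \<Longrightarrow> 0 \<le> block_tr T"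
  unfolding block_tr_sum by (intro add_nonneg_nonneg sum_nonneg) (auto simp: block_psd_def)

lemma block_tr_eq_0:
  assumes T: "block_psd T" and "block_tr T = 0"
  shows "T = 0"
proof -
  have nn: "0 \<le> z \<bullet> block_op T z" for z using T unfolding block_psd_def by blast
  have "(\<Sum>i\<in>UNIV. (axis i 1, 0) \<bullet> block_op T (axis i 1, 0)) = 0"
    "(\<Sum>i\<in>UNIV. (0, axis i 1) \<bullet> block_op T (0, axis i 1)) = 0"
    using assms(2) nn unfolding block_tr_sum by (smt (verit) sum_nonneg)+
  then have "(axis i 1, 0) \<bullet> block_op T (axis i 1, 0) = 0" "(0, axis i 1) \<bullet> block_op T (0, axis i 1) = 0" for i
    using nn by (simp_all add: sum_nonneg_eq_0_iff)
  then show ?thesis using block_psd_kernel[OF T] by (intro block_op_axis) auto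
qed

lemma ray_tr_pos: "ray T \<Longrightarrow> block_tr T > 0"
  using block_tr_nonneg[of T] block_tr_eq_0[of T] by (auto simp: ray_def ppt_def order_less_le)

lemma block_op_product: "block_op (product_block a b v) (p, q) =
    ((cdot (a *s v) p + cdot (b *s v) q) *s (a *s v), (cdot (a *s v) p + cdot (b *s v) q) *s (b *s v))"
  by (simp add: block_op_def product_block_def outer_mult_vec vec_eq_iff algebra_simps)

lemma flip_product: "flip (product_block a b v) = product_block (cnj a) (cnj b) v"
  by (simp add: flip_def product_block_def vec_eq_iff)

lemma block_herm_product: "block_herm (product_block a b v)"
  by (simp add: block_herm_def product_block_def)

lemma block_psd_product: "block_psd (product_block a b v)"
proof -
  have "0 \<le> (p, q) \<bullet> block_op (product_block a b v) (p, q)" for p q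
  proof -
    define k where "k = cdot (a *s v) p + cdot (b *s v) q"
    have "cdot p (k *s (a *s v)) + cdot q (k *s (b *s v)) = k * cnj k"
      by (simp add: k_def cdot_add_right cdot_scale_left cdot_scale_right cnj_cdot algebra_simps)
    also have "\<dots> = complex_of_real (cmod k ^ 2)" by (simp only: complex_norm_square)
    finally have "Re (cdot p (k *s (a *s v)) + cdot q (k *s (b *s v))) = cmod k ^ 2" by simp
    then show ?thesis by (simp add: block_op_product Re_cdot flip: k_def)
  qed
  then show ?thesis by (auto simp: block_psd_def block_herm_product)
qed

lemma product_scale:
  assumes "0 \<le> r" shows "r *\<^sub>R product_block a b v = product_block a b (complex_of_real (sqrt r) *s v)"
proof -
  have "complex_of_real (sqrt r) * complex_of_real (sqrt r) = complex_of_real r"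
    using assms by (metis of_real_mult real_sqrt_mult_self abs_of_nonneg)
  then show ?thesis
    by (simp add: product_block_def vec_eq_iff scaleR_conv_of_real[where 'a=complex] mult_ac)
qed

lemma product_blocks_scale: "P \<in> product_blocks \<Longrightarrow> 0 \<le> r \<Longrightarrow> r *\<^sub>R P \<in> product_blocks"
  unfolding product_blocks_def mem_Collect_eq using product_scale by metis

lemma flip_product_blocks: "flip T \<in> product_blocks \<Longrightarrow> T \<in> product_blocks"
proof -
  assume "flip T \<in> product_blocks"
  then obtain a b v where "flip T = product_block a b v" unfolding product_blocks_def by blast
  then have "T = product_block (cnj a) (cnj b) v" by (metis flip_flip flip_product)
  then show ?thesis unfolding product_blocks_def by blast
qed

lemma ray_flip: "ray T \<Longrightarrow> ray (flip T)"
proof -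
  assume T: "ray T"
  have "\<exists>t. Y = t *\<^sub>R flip T" if Y: "ppt Y" "ppt (flip T - Y)" for Y
  proof -
    have "ppt (flip Y)" using Y(1) by (simp only: ppt_flip)
    moreover have "ppt (T - flip Y)" using Y(2) ppt_flip[of "flip T - Y"] by (simp only: flip_diff flip_flip)
    ultimately obtain t where "flip Y = t *\<^sub>R T" using T unfolding ray_def by blast
    then have "Y = t *\<^sub>R flip T" by (metis flip_flip flip_scaleR)
    then show ?thesis by blast
  qed
  moreover have "flip T \<noteq> 0" using T unfolding ray_def by (metis flip_0 flip_flip)
  moreover have "ppt (flip T)" using T unfolding ray_def by (simp only: ppt_flip)
  ultimately show ?thesis unfolding ray_def by blast
qed

text \<open>The kernel conditions say that \<open>(a, b) (x) v\<close> lies in the range of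
  \<open>T\<close>, and \<open>(cnj a, cnj b) (x) v\<close> in that of \<open>flip T\<close>. The
  product block is then an admissible perturbation, hence a multiple of \<open>T\<close>, and
  comparing traces shows that the factor is positive.\<close>

lemma ray_subtract:
  assumes T: "ray T" and P: "product_block a b v \<noteq> 0"
    and ker: "\<And>p q. block_op T (p, q) = 0 \<Longrightarrow> cdot (a *s v) p + cdot (b *s v) q = 0"
      "\<And>p q. block_op (flip T) (p, q) = 0 \<Longrightarrow> cdot (cnj a *s v) p + cdot (cnj b *s v) q = 0"
  shows "T \<in> product_blocks"
proof -
  have "\<exists>s. product_block a b v = s *\<^sub>R T"
  proof (rule ray_perturb[OF T block_herm_product])
    fix z show "block_op (product_block a b v) z = 0" if "block_op T z = 0"
      using ker(1)[of "fst z" "snd z"] that by (cases z) (simp add: block_op_product zero_prod_def)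
    show "block_op (flip (product_block a b v)) z = 0" if "block_op (flip T) z = 0"
      using ker(2)[of "fst z" "snd z"] that by (cases z) (simp add: block_op_product flip_product zero_prod_def)
  qed
  then obtain s where s: "product_block a b v = s *\<^sub>R T" by blast
  have "block_tr (product_block a b v) > 0"
    using block_tr_nonneg[OF block_psd_product] block_tr_eq_0[OF block_psd_product] P
    by (metis order_less_le)
  then have "s * block_tr T > 0" unfolding s by (simp add: linear_scale[OF linear_block_tr])
  then have "s > 0" using ray_tr_pos[OF T] by (simp add: zero_less_mult_iff)
  then have "T = product_block a b (complex_of_real (sqrt (1 / s)) *s v)"
    using product_scale[of "1 / s" a b v] by (simp add: s)
  then show ?thesis unfolding product_blocks_def by blast
qed

text \<open>The Schur complement of the corner 1 is the form at
  \<open>(u, - adj B u)\<close>.\<close>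

lemma block_psd_schur:
  assumes T: "block_psd (A, B, mat 1)"
  shows "psd (A - B ** adj B)"
proof -
  have "0 \<le> u \<bullet> ((A - B ** adj B) *v u)" for u
  proof -
    have "block_op (A, B, mat 1) (u, - (adj B *v u)) = ((A - B ** adj B) *v u, 0)"
      by (simp add: block_op_def matrix_vector_mult_diff_rdistrib matrix_vector_mul_assoc
          linear_neg[OF linear_matrix_vec])
    moreover have "0 \<le> (u, - (adj B *v u)) \<bullet> block_op (A, B, mat 1) (u, - (adj B *v u))"
      using T by (simp only: block_psd_def)
    ultimately show ?thesis by simp
  qed
  moreover have "adj A = A" using T by (simp add: block_psd_def block_herm_def)
  ultimately show ?thesis by (simp add: psd_iff adj_diff adj_mult)
qed

lemma block_op_schur_kernel:
  assumes "block_op (A, B, mat 1) (p, q) = 0"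
  shows "q = - (adj B *v p)" "(A - B ** adj B) *v p = 0"
proof -
  have 1: "A *v p + B *v q = 0" and 2: "adj B *v p + q = 0"
    using assms by (simp_all add: block_op_def zero_prod_def)
  from 2 show q: "q = - (adj B *v p)" by (simp add: eq_neg_iff_add_eq_0 add.commute)
  show "(A - B ** adj B) *v p = 0"
    using 1 by (simp add: q matrix_vector_mult_diff_rdistrib matrix_vector_mul_assoc
        linear_neg[OF linear_matrix_vec])
qed

lemma ray_subtract_first:
  assumes T: "ray (A, B, mat 1)" and x: "x \<noteq> 0"
    and D1: "\<And>p. (A - B ** adj B) *v p = 0 \<Longrightarrow> cdot x p = 0"
    and D2: "\<And>p. (A - adj B ** B) *v p = 0 \<Longrightarrow> cdot x p = 0"
  shows "(A, B, mat 1) \<in> product_blocks"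
proof (rule ray_subtract[OF T, of 1 0 x])
  show "product_block 1 0 x \<noteq> 0" using x by (simp add: product_block_def zero_prod_def outer_self_eq_0)
  show "cdot (1 *s x) p + cdot (0 *s x) q = 0" if "block_op (A, B, mat 1) (p, q) = 0" for p q
    using block_op_schur_kernel(2)[OF that] D1 by (simp add: cdot_scale_left)
  show "cdot (cnj 1 *s x) p + cdot (cnj 0 *s x) q = 0" if "block_op (flip (A, B, mat 1)) (p, q) = 0" for p q
    using block_op_schur_kernel(2)[of A "adj B" p q] that D2 by (simp add: flip_def cdot_scale_left)
qed

text \<open>If \<open>x\<close> is nonzero and \<open>y\<close> a multiple of it, then
  \<open>x\<close> lies in the ranges of both complements and \<open>(1, 0) (x) x\<close> can be
  subtracted; otherwise \<open>range_vector\<close> supplies \<open>(z, 1) (x) v\<close>.\<close>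

lemma ray_rank_one:
  fixes A :: "complex^'n^'n"
  assumes card: "CARD('n) \<le> 3" and T: "ray (A, B, mat 1)"
    and D1: "A - B ** adj B = outer x x" and D2: "A - adj B ** B = outer y y"
  shows "(A, B, mat 1) \<in> product_blocks"
proof -
  have S: "B ** adj B + outer x x = adj B ** B + outer y y"
    using D1 D2 by (metis add.commute diff_add_cancel)
  have kx: "cdot x p = 0" if "(A - B ** adj B) *v p = 0" for p
    using that unfolding D1 by (cases "x = 0") (auto simp: outer_mult_vec)
  have ky: "cdot y p = 0" if "(A - adj B ** B) *v p = 0" for p
    using that unfolding D2 by (cases "y = 0") (auto simp: outer_mult_vec)
  show ?thesis
  proof (cases "x = 0 \<or> (\<forall>c. y \<noteq> c *s x)")
    case False
    then obtain c where x: "x \<noteq> 0" and c: "y = c *s x" by blast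
    have "c \<noteq> 0" using x c commutator_traces(1)[OF S] by auto
    then show ?thesis
      using kx ky x by (intro ray_subtract_first[OF T, of x]) (auto simp: c cdot_scale_left)
  next
    case True
    obtain v z t s where v: "v \<noteq> 0" and 1: "B *v v + t *s x = z *s v"
      and 2: "adj B *v v + s *s y = cnj z *s v"
      using range_vector[OF card S True] by blast
    have 1: "z *s v - B *v v = t *s x" and 2: "cnj z *s v - adj B *v v = s *s y"
      using 1 2 by (metis add_diff_cancel_left')+
    show ?thesis
    proof (rule ray_subtract[OF T, of z 1 v])
      show "product_block z 1 v \<noteq> 0" using v by (simp add: product_block_def zero_prod_def outer_self_eq_0)
      show "cdot (z *s v) p + cdot (1 *s v) q = 0" if k: "block_op (A, B, mat 1) (p, q) = 0" for p q
      proof -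
        have "cdot (z *s v) p + cdot v q = cdot (z *s v - B *v v) p"
          using block_op_schur_kernel(1)[OF k] by (simp add: cdot_minus cdot_diff_left cdot_adj)
        also have "\<dots> = 0" using kx[OF block_op_schur_kernel(2)[OF k]] by (simp add: 1 cdot_scale_left)
        finally show ?thesis by simp
      qed
      show "cdot (cnj z *s v) p + cdot (cnj 1 *s v) q = 0"
        if k: "block_op (flip (A, B, mat 1)) (p, q) = 0" for p q
      proof -
        have k: "block_op (A, adj B, mat 1) (p, q) = 0" using k by (simp add: flip_def)
        have "cdot (cnj z *s v) p + cdot v q = cdot (cnj z *s v - adj B *v v) p"
          using block_op_schur_kernel(1)[OF k] by (simp add: cdot_minus cdot_diff_left cdot_adj)
        also have "\<dots> = 0"
          using ky block_op_schur_kernel(2)[OF k] by (simp add: 2 cdot_scale_left)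
        finally show ?thesis by simp
      qed
    qed
  qed
qed

lemma psd_nonzero_form:
  assumes "psd X" "X \<noteq> 0"
  obtains v where "v \<bullet> (X *v v) \<noteq> 0"
  using psd_kernel[OF assms(1)] matrix_ext[of X 0] assms(2) by auto

lemma psd_trace_eq_0:
  assumes D: "psd D" and "Re (trace D) = 0"
  shows "D = 0"
proof (rule ccontr)
  assume "D \<noteq> 0"
  then obtain i where "D *v axis i 1 \<noteq> 0" by (metis matrix_vec_axis vec_eq_iff zero_index)
  then have "axis i 1 \<bullet> (D *v axis i 1) \<noteq> 0" using psd_kernel[OF D] by blast
  moreover have nn: "0 \<le> axis j 1 \<bullet> (D *v axis j 1)" for j using D by (simp add: psd_iff)
  ultimately have "0 < (\<Sum>j\<in>UNIV. axis j 1 \<bullet> (D *v axis j 1))"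
    by (intro sum_pos2[of _ i]) (auto simp: order_less_le)
  also have "(\<Sum>j\<in>UNIV. axis j 1 \<bullet> (D *v axis j 1)) = (\<Sum>j\<in>UNIV. Re (D $ j $ j))"
    by (intro sum.cong refl) (metis Re_cdot cdot_axis(1) matrix_vec_axis)
  finally show False using assms(2) by (simp add: trace_def)
qed

text \<open>Two rank-one terms can be split off \<open>D\<close>, which gives two independent
  vectors orthogonal to its kernel. Together with \<open>u0\<close> they exhaust a space of
  dimension at most 3.\<close>

lemma psd_rank_ge_2_kernel:
  fixes D :: "complex^'n^'n"
  assumes card: "CARD('n) \<le> 3" and D: "psd D" and rank: "\<And>y. D \<noteq> outer y y"
    and u0: "D *v u0 = 0" "u0 \<noteq> 0"
  shows "CARD('n) = 3" "\<And>u. D *v u = 0 \<Longrightarrow> \<exists>c. u = c *s u0"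
proof -
  have "D \<noteq> 0" using rank[of 0] by (metis outer_self_eq_0)
  then obtain v where v: "v \<bullet> (D *v v) \<noteq> 0" using psd_nonzero_form[OF D] by blast
  from psd_subtract_outer[OF D v] obtain y where y: "psd (D - outer y y)" "(D - outer y y) *v v = 0"
    "\<And>u. D *v u = 0 \<Longrightarrow> (D - outer y y) *v u = 0" "\<And>u. D *v u = 0 \<Longrightarrow> cdot y u = 0" "cdot y v \<noteq> 0"
    by blast
  have "D - outer y y \<noteq> 0" using rank[of y] by auto
  then obtain v' where v': "v' \<bullet> ((D - outer y y) *v v') \<noteq> 0" using psd_nonzero_form[OF y(1)] by blast
  from psd_subtract_outer(4,5)[OF y(1) v'] obtain z where z: "z \<noteq> 0"
    "\<And>u. (D - outer y y) *v u = 0 \<Longrightarrow> cdot z u = 0" by blast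
  have y0: "y \<noteq> 0" using y(5) by auto
  \<comment> \<open>Gram-Schmidt for \<open>y\<close> and \<open>z\<close>. They are independent
    because \<open>z\<close> is orthogonal to \<open>v\<close> and \<open>y\<close> is not.\<close>
  define k where "k = cdot y z / cdot y y"
  define w where "w = z - k *s y"
  have yw: "cdot y w = 0" using y0 by (simp add: w_def k_def cdot_diff_right cdot_scale_right)
  have w0: "w \<noteq> 0"
  proof
    assume "w = 0"
    then have e: "z = k *s y" by (simp add: w_def)
    have "cdot z v = 0" using z(2) y(2) by blast
    then have "k = 0" using y(5) by (simp add: e cdot_scale_left)
    with e z(1) show False by simp
  qed
  have ker: "cdot y u = 0" "cdot w u = 0" if "D *v u = 0" for u
    using that y(3,4) z(2) by (simp_all add: w_def cdot_diff_left cdot_scale_left)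
  have wy: "cdot w y = 0" using yw by (metis cnj_cdot complex_cnj_zero)
  have u0': "cdot u0 y = 0" "cdot u0 w = 0" using ker[OF u0(1)] by (metis cnj_cdot complex_cnj_zero)+
  show "CARD('n) = 3"
    using orthogonal_3_card[OF y0 w0 u0(2) wy u0'] card by simp
  show "\<exists>c. u = c *s u0" if u: "D *v u = 0" for u
  proof -
    define c where "c = cdot u0 u / cdot u0 u0"
    define d where "d = u - c *s u0"
    have "cdot u0 d = 0" using u0 by (simp add: d_def c_def cdot_diff_right cdot_scale_right)
    moreover have "cdot y d = 0" "cdot w d = 0"
      using ker[OF u] ker[OF u0(1)] by (simp_all add: d_def cdot_diff_right cdot_scale_right)
    ultimately have "cdot d u0 = 0" "cdot d y = 0" "cdot d w = 0"
      by (metis cnj_cdot complex_cnj_zero)+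
    then have "d = 0" using orthogonal_card_le_3[OF card y0 w0 u0(2) wy u0'] by blast
    then show ?thesis by (auto simp: d_def)
  qed
qed

section \<open>Perturbations obtained by counting real parameters\<close>

lemma linear_kernel_nontrivial:
  fixes f :: "'a::euclidean_space \<Rightarrow> 'b::euclidean_space"
  assumes f: "linear f" and "DIM('b) < DIM('a)"
  shows "\<exists>x. x \<noteq> 0 \<and> f x = 0"
proof (rule ccontr)
  assume "\<not> ?thesis"
  then have "inj f" using linear_injective_0[OF f] by blast
  then have "dim (range f) = DIM('a)" using dim_image_eq[OF f, of UNIV] by (simp add: inj_on_def)
  moreover have "dim (range f) \<le> DIM('b)" by (rule dim_subset_UNIV)
  ultimately show False using assms(2) by simp
qed

text \<open>Arbitrary real matrices parametrise the Hermitian ones bijectively, the symmetric part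
  giving real parts and the antisymmetric part imaginary parts. So the number \<open>n^2\<close> of
  parameters becomes the dimension of a type and can enter a rank-nullity argument.\<close>

definition herm_of :: "real^'n^'n \<Rightarrow> complex^'n^'n" where
  "herm_of R = (\<chi> i j. Complex (R $ i $ j + R $ j $ i) (R $ i $ j - R $ j $ i))"

lemma adj_herm_of: "adj (herm_of R) = herm_of R"
  by (simp add: herm_of_def vec_eq_iff complex_eq_iff)

lemma herm_of_eq_0: "herm_of R = 0 \<longleftrightarrow> R = 0"
proof
  assume *: "herm_of R = 0"
  have "R $ i $ j = 0" for i j
    using arg_cong[OF *, of "\<lambda>M. M $ i $ j"] by (simp add: herm_of_def complex_eq_iff)
  then show "R = 0" by (simp add: vec_eq_iff)
qed (simp add: herm_of_def vec_eq_iff complex_eq_iff)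

text \<open>
  This is \<open>Y K Y\<^sup>*\<close>, where \<open>Y\<close> has the block rows \<open>B, x\<close> and \<open>1, 0\<close> and \<open>K\<close> is Hermitian of size \<open>n + 1\<close>, given by
  \<open>n\<^sup>2 + 2 n + 1\<close> real parameters. The range of \<open>Y\<close> lies in the range of \<open>(A, B, 1)\<close> if \<open>x\<close> is orthogonal to
  the kernel of \<open>A - B B\<^sup>*\<close>.
\<close>

definition range_block :: "complex^'n^'n \<Rightarrow> complex^'n \<Rightarrow> (real^'n^'n) \<times> (complex^'n) \<times> real \<Rightarrow> 'n::finite blocks" where
  "range_block B x = (\<lambda>(R, k, r). (B ** herm_of R ** adj B + outer (B *v k) x + outer x (B *v k) + r *\<^sub>R outer x x,
     B ** herm_of R + outer x k, herm_of R))"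

lemma herm_of_add: "herm_of (R + S) = herm_of R + herm_of S"
  and herm_of_scaleR: "herm_of (c *\<^sub>R R) = c *\<^sub>R herm_of R"
  by (simp_all add: herm_of_def vec_eq_iff complex_eq_iff algebra_simps)

lemma outer_add_left: "outer (u + v) x = outer u x + outer v x"
  and outer_add_right: "outer x (u + v) = outer x u + outer x v"
  and outer_scaleR_left: "outer (c *\<^sub>R u) x = c *\<^sub>R outer u x"
  and outer_scaleR_right: "outer x (c *\<^sub>R u) = c *\<^sub>R outer x u"
  by (simp_all add: vec_eq_iff algebra_simps)

lemma matrix_add_rdistrib: "(A + B) ** C = A ** C + B ** C" for A B :: "complex^'n^'m"
  by (simp add: vec_eq_iff matrix_matrix_mult_def algebra_simps sum.distrib)

lemma linear_range_block: "linear (range_block B x)"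
  by (rule linearI)
    (auto simp: range_block_def herm_of_add herm_of_scaleR matrix_add_ldistrib matrix_add_rdistrib
      matrix_mult_scaleR_left matrix_mult_scaleR_right matrix_vector_right_distrib matrix_vec_scaleR
      outer_add_left outer_add_right outer_scaleR_left outer_scaleR_right algebra_simps)

lemma range_block_eq_0:
  assumes "x \<noteq> 0" "range_block B x K = 0"
  shows "K = 0"
proof -
  obtain R k r where K: "K = (R, k, r)" by (cases K)
  have e: "herm_of R = 0" "B ** herm_of R + outer x k = 0"
    "B ** herm_of R ** adj B + outer (B *v k) x + outer x (B *v k) + r *\<^sub>R outer x x = 0"
    using assms(2) unfolding K range_block_def zero_prod_def prod.case prod.inject by blast+
  then have R: "R = 0" by (simp add: herm_of_eq_0)
  have o: "outer x k = 0" using e(1,2) by (simp add: matrix_matrix_mult_def vec_eq_iff)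
  obtain i where i: "x $ i \<noteq> 0" using assms(1) by (auto simp: vec_eq_iff)
  have "k $ j = 0" for j using arg_cong[OF o, of "\<lambda>M. M $ i $ j"] i by simp
  then have k: "k = 0" by (simp add: vec_eq_iff)
  have "r *\<^sub>R outer x x = 0" using e(1,3) k by (simp add: matrix_matrix_mult_def vec_eq_iff)
  then have "r = 0" using assms(1) by (simp add: outer_self_eq_0)
  with R k K show ?thesis by (simp add: zero_prod_def)
qed

lemma range_block_herm: "block_herm (range_block B x K)"
  by (cases K) (simp add: range_block_def block_herm_def adj_add adj_mult adj_scaleR adj_herm_of
      matrix_mul_assoc add_ac)

text \<open>The block matrix is \<open>Y K Y*\<close>, and \<open>Y*\<close> maps
  \<open>(p, q)\<close> to \<open>adj B p + q\<close> and \<open>cdot x p\<close>, which both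
  vanish.\<close>

lemma range_block_kernel:
  assumes q: "q = - (adj B *v p)" and p: "cdot x p = 0"
  shows "block_op (range_block B x K) (p, q) = 0"
proof -
  obtain R k r where K: "K = (R, k, r)" by (cases K)
  have c: "cdot (B *v k) p = cdot k (adj B *v p)" by (rule cdot_adj')
  show ?thesis
    by (simp add: K range_block_def block_op_def q p c cdot_minus vec_eq_iff zero_prod_def matrix_vector_mult_add_rdistrib
        outer_mult_vec adj_add adj_mult adj_herm_of linear_neg[OF linear_matrix_vec] scaleR_matrix_vec
        flip: matrix_vector_mul_assoc)
qed

text \<open>
  If \<open>A - B\<^sup>* B\<close> is singular, then \<open>n = 3\<close> and its kernel is spanned by one vector \<open>u0\<close>; the conditions
  on the perturbation are \<open>4 n + 1 = 13\<close> real equations for \<open>16\<close> parameters.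
\<close>

lemma ray_high_rank:
  fixes A :: "complex^'n^'n"
  assumes card: "CARD('n) \<le> 3" and T: "ray (A, B, mat 1)"
    and rank: "\<And>y. A - adj B ** B \<noteq> outer y y"
  shows "(A, B, mat 1) \<in> product_blocks"
proof -
  have psd: "block_psd (A, B, mat 1)" "block_psd (A, adj B, mat 1)"
    using T by (simp_all add: ray_def ppt_def flip_def)
  define D1 where "D1 = A - B ** adj B"
  define D2 where "D2 = A - adj B ** B"
  have D1: "psd D1" and D2: "psd D2"
    using block_psd_schur[OF psd(1)] block_psd_schur[OF psd(2)] by (simp_all add: D1_def D2_def)
  \<comment> \<open>\<open>D1\<close> and \<open>D2\<close> have equal traces, so they vanish
    together.\<close>
  have "D1 \<noteq> 0"
  proof
    assume "D1 = 0"
    have "trace D2 = 0"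
      using \<open>D1 = 0\<close> by (simp add: D1_def D2_def trace_sub trace_mul_sym[of "adj B" B])
    then have "D2 = 0" using psd_trace_eq_0[OF D2] by simp
    then show False using rank[of 0] by (metis D2_def outer_self_eq_0)
  qed
  then obtain v where v: "D1 *v v \<noteq> 0" using matrix_ext[of D1 0] by auto
  define x where "x = D1 *v v"
  have x: "x \<noteq> 0" using v by (simp add: x_def)
  have D1x: "cdot x p = 0" if "D1 *v p = 0" for p
    using D1 that by (simp add: x_def cdot_adj' psd_iff)
  show ?thesis
  proof (cases "\<exists>u. u \<noteq> 0 \<and> D2 *v u = 0")
    case False
    \<comment> \<open>\<open>D2\<close> is injective, so its range is everything and any nonzero
      \<open>x\<close> in the range of \<open>D1\<close> can be used.\<close>
    then have "p = 0" if "D2 *v p = 0" for p using that by blast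
    then have "cdot x p = 0" if "D2 *v p = 0" for p using that by (metis cdot_zero(2))
    then show ?thesis using ray_subtract_first[OF T x] D1x by (simp add: D1_def D2_def)
  next
    case True
    then obtain u0 where u0: "u0 \<noteq> 0" "D2 *v u0 = 0" by blast
    have rank': "D2 \<noteq> outer y y" for y using rank by (simp add: D2_def)
    note ker = psd_rank_ge_2_kernel[OF card D2 rank' u0(2,1)]
    \<comment> \<open>The first two components vanish iff the flipped perturbation kills
      \<open>(u0, - B u0)\<close>, which spans the kernel of \<open>flip\<close> of the ray. The
      trace is added to exclude nonzero multiples of the ray.\<close>
    define g where "g = (\<lambda>(a, b, c). ((b - c ** B) *v u0, (a - adj b ** B) *v u0, block_tr (a, b, c)))"
    have g: "linear g"
    proof (rule linearI)
      show "g (S + T) = g S + g T" for S T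
        using linear_add[OF linear_block_tr, of S T]
        by (cases S; cases T) (simp add: g_def adj_add matrix_add_rdistrib matrix_vector_mult_add_rdistrib
            matrix_vector_mult_diff_rdistrib)
      show "g (c *\<^sub>R T) = c *\<^sub>R g T" for c T
        using linear_scale[OF linear_block_tr, of c T]
        by (cases T) (simp add: g_def adj_scaleR matrix_mult_scaleR_left
            matrix_vector_mult_diff_rdistrib scaleR_matrix_vec scaleR_diff_right)
    qed
    have "linear (g \<circ> range_block B x)" using linear_range_block g by (rule linear_compose)
    then obtain K where K: "K \<noteq> 0" "g (range_block B x K) = 0"
      using linear_kernel_nontrivial[of "g \<circ> range_block B x"] ker(1) by auto
    obtain a b c where H: "range_block B x K = (a, b, c)" by (cases "range_block B x K")
    have eq: "(b - c ** B) *v u0 = 0" "(a - adj b ** B) *v u0 = 0" "block_tr (a, b, c) = 0"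
      using K(2) by (simp_all add: H g_def zero_prod_def)
    have "\<exists>s. (a, b, c) = s *\<^sub>R (A, B, mat 1)"
    proof (rule ray_perturb[OF T])
      show "block_herm (a, b, c)" using range_block_herm[of B x K] by (simp add: H)
      show "block_op (a, b, c) z = 0" if "block_op (A, B, mat 1) z = 0" for z
      proof -
        obtain p q where z: "z = (p, q)" by (cases z)
        note k = block_op_schur_kernel[OF that[unfolded z]]
        have "cdot x p = 0" using k(2) D1x by (simp add: D1_def)
        then show ?thesis using range_block_kernel[OF k(1), of x K] by (simp add: H z)
      qed
      show "block_op (flip (a, b, c)) z = 0" if "block_op (flip (A, B, mat 1)) z = 0" for z
      proof -
        obtain p q where z: "z = (p, q)" by (cases z)
        have "block_op (A, adj B, mat 1) (p, q) = 0" using that by (simp add: z flip_def)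
        note k = block_op_schur_kernel[OF this, unfolded adj_adj]
        obtain m where p: "p = m *s u0" using ker(2) k(2) by (auto simp: D2_def)
        have "(b - c ** B) *v p = 0" "(a - adj b ** B) *v p = 0"
          by (simp_all add: p matrix_vec_scale eq)
        then show ?thesis
          by (simp add: z flip_def block_op_def k(1) zero_prod_def matrix_vector_mult_diff_rdistrib
              linear_neg[OF linear_matrix_vec] flip: matrix_vector_mul_assoc)
      qed
    qed
    then obtain s where s: "(a, b, c) = s *\<^sub>R (A, B, mat 1)" by blast
    have "s * block_tr (A, B, mat 1) = 0"
      using eq(3) unfolding s by (simp only: linear_scale[OF linear_block_tr] real_scaleR_def)
    then have "s = 0" using ray_tr_pos[OF T] by simp
    then have "range_block B x K = 0" unfolding H s by (simp only: scaleR_zero_left)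
    then have "K = 0" by (rule range_block_eq_0[OF x])
    with K(1) show ?thesis by simp
  qed
qed

lemma ray_normalized:
  fixes A :: "complex^'n^'n"
  assumes card: "CARD('n) \<le> 3" and T: "ray (A, B, mat 1)"
  shows "(A, B, mat 1) \<in> product_blocks"
proof (cases "\<forall>y. A - adj B ** B \<noteq> outer y y")
  case True
  then show ?thesis using ray_high_rank[OF card T] by blast
next
  case F2: False
  show ?thesis
  proof (cases "\<forall>y. A - B ** adj B \<noteq> outer y y")
    case True
    have "ray (A, adj B, mat 1)" using ray_flip[OF T] by (simp add: flip_def)
    then have "(A, adj B, mat 1) \<in> product_blocks"
      by (rule ray_high_rank[OF card]) (use True in simp)
    then show ?thesis using flip_product_blocks[of "(A, B, mat 1)"] by (simp add: flip_def)
  next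
    case False
    then show ?thesis using F2 ray_rank_one[OF card T] by blast
  qed
qed

subsection \<open>From rays to separability\<close>

text \<open>Congruence by \<open>1 (x) L\<close>. A rectangular \<open>L\<close> is allowed, so that
  it can also change the dimension.\<close>

definition congr_block :: "complex^'m^'n \<Rightarrow> 'n::finite blocks \<Rightarrow> 'm::finite blocks" where
  "congr_block L = (\<lambda>(A, B, C). (adj L ** A ** L, adj L ** B ** L, adj L ** C ** L))"

lemma linear_congr_block: "linear (congr_block L)"
  by (rule linearI) (auto simp: congr_block_def matrix_add_ldistrib matrix_add_rdistrib
      matrix_mult_scaleR_left matrix_mult_scaleR_right)

lemma flip_congr_block: "flip (congr_block L T) = congr_block L (flip T)"
  by (cases T) (simp add: flip_def congr_block_def adj_mult matrix_mul_assoc)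

lemma congr_block_compose: "congr_block M (congr_block L T) = congr_block (L ** M) T"
  by (cases T) (simp add: congr_block_def adj_mult matrix_mul_assoc)

lemma congr_block_id: "congr_block (mat 1) T = T"
  by (cases T) (simp add: congr_block_def)

lemma block_psd_congr:
  assumes "block_psd T" shows "block_psd (congr_block L T)"
proof -
  obtain A B C where T: "T = (A, B, C)" by (cases T)
  have "0 \<le> (u, v) \<bullet> block_op (congr_block L T) (u, v)" for u v
  proof -
    have "block_op (congr_block L T) (u, v) =
        (adj L *v fst (block_op T (L *v u, L *v v)), adj L *v snd (block_op T (L *v u, L *v v)))"
      by (simp add: T congr_block_def block_op_def adj_mult matrix_vector_right_distrib
          flip: matrix_vector_mul_assoc)
    then have "(u, v) \<bullet> block_op (congr_block L T) (u, v) = (L *v u, L *v v) \<bullet> block_op T (L *v u, L *v v)"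
      by (simp add: inner_adj inner_prod_def)
    then show ?thesis using assms unfolding block_psd_def by metis
  qed
  moreover have "block_herm (congr_block L T)"
    using assms by (simp add: T block_psd_def block_herm_def congr_block_def adj_mult matrix_mul_assoc)
  ultimately show ?thesis unfolding block_psd_def by (simp only: split_paired_All) blast
qed

lemma ppt_congr: "ppt T \<Longrightarrow> ppt (congr_block L T)"
  by (simp add: ppt_def flip_congr_block block_psd_congr)

lemma mult_outer_mult: "M ** outer x y ** N = outer (M *v x) (adj N *v y)"
  by (rule matrix_ext)
    (simp add: outer_mult_vec cdot_adj matrix_vec_scale flip: matrix_vector_mul_assoc)

lemma congr_product: "congr_block L (product_block a b v) = product_block a b (adj L *v v)"
  by (simp add: congr_block_def product_block_def mult_outer_mult matrix_vec_scale)

lemma congr_product_blocks: "P \<in> product_blocks \<Longrightarrow> congr_block L P \<in> product_blocks"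
  unfolding product_blocks_def using congr_product by blast

lemma congr_hull: "T \<in> convex hull product_blocks \<Longrightarrow> congr_block L T \<in> convex hull product_blocks"
  using convex_hull_linear_image[OF linear_congr_block, of L product_blocks]
    hull_mono[of "congr_block L ` product_blocks" product_blocks convex] congr_product_blocks
  by blast

lemma ray_congr:
  fixes L :: "complex^'n^'n"
  assumes T: "ray T" and LM: "L ** M = mat 1" "M ** L = mat 1"
  shows "ray (congr_block L T)"
proof -
  have inv: "congr_block M (congr_block L S) = S" "congr_block L (congr_block M S) = S" for S
    by (simp_all add: congr_block_compose LM congr_block_id)
  have "\<exists>t. Y = t *\<^sub>R congr_block L T" if Y: "ppt Y" "ppt (congr_block L T - Y)" for Y
  proof -
    have "ppt (congr_block M Y)" "ppt (congr_block M (congr_block L T - Y))"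
      using Y by (simp_all only: ppt_congr)
    then have "ppt (congr_block M Y)" "ppt (T - congr_block M Y)"
      by (simp_all only: linear_diff[OF linear_congr_block] inv)
    then obtain t where "congr_block M Y = t *\<^sub>R T" using T unfolding ray_def by blast
    then have "congr_block L (congr_block M Y) = t *\<^sub>R congr_block L T"
      by (simp only: linear_scale[OF linear_congr_block])
    then show ?thesis unfolding inv by blast
  qed
  moreover have "congr_block L T \<noteq> 0"
  proof
    assume "congr_block L T = 0"
    then have "T = 0" using inv(1)[of T] by (metis linear_0 linear_congr_block)
    with T show False by (simp add: ray_def)
  qed
  moreover have "ppt (congr_block L T)" using T ppt_congr unfolding ray_def by blast
  ultimately show ?thesis unfolding ray_def by blast
qed

text \<open>If \<open>C f = 0\<close>, positivity of the triple and of its flip gives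
  \<open>B f = 0\<close> and \<open>adj B f = 0\<close>; so \<open>A f\<close> is nonzero, and
  \<open>(1, 0) (x) A f\<close> is in both ranges, being the image of \<open>(f, 0)\<close>. If
  \<open>C\<close> is invertible, a congruence turns it into 1.\<close>

lemma ray_no_joint_kernel:
  fixes A :: "complex^'n^'n"
  assumes card: "CARD('n) \<le> 3" and T: "ray (A, B, C)"
    and joint: "\<And>f. A *v f = 0 \<Longrightarrow> B *v f = 0 \<Longrightarrow> adj B *v f = 0 \<Longrightarrow> C *v f = 0 \<Longrightarrow> f = 0"
  shows "(A, B, C) \<in> product_blocks"
proof -
  have psd: "block_psd (A, B, C)" "block_psd (A, adj B, C)"
    using T by (simp_all add: ray_def ppt_def flip_def)
  have hA: "adj A = A" and hC: "adj C = C" using psd by (simp_all add: block_psd_def block_herm_def)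
  have psdC: "psd C"
  proof -
    have "0 \<le> v \<bullet> (C *v v)" for v
    proof -
      have "0 \<le> (0, v) \<bullet> block_op (A, B, C) (0, v)" using psd(1) by (simp only: block_psd_def)
      then show ?thesis by (simp add: block_op_def)
    qed
    then show ?thesis by (simp add: psd_iff hC)
  qed
  show ?thesis
  proof (cases "\<exists>f. f \<noteq> 0 \<and> C *v f = 0")
    case True
    then obtain f where f: "f \<noteq> 0" "C *v f = 0" by blast
    have "block_op (A, B, C) (0, f) = 0"
      by (rule block_psd_kernel[OF psd(1)]) (simp add: block_op_def f)
    then have Bf: "B *v f = 0" by (simp add: block_op_def zero_prod_def)
    have "block_op (A, adj B, C) (0, f) = 0"
      by (rule block_psd_kernel[OF psd(2)]) (simp add: block_op_def f)
    then have Bf': "adj B *v f = 0" by (simp add: block_op_def zero_prod_def)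
    have Af: "A *v f \<noteq> 0" using joint f Bf Bf' by blast
    show ?thesis
    proof (rule ray_subtract[OF T, of 1 0 "A *v f"])
      show "product_block 1 0 (A *v f) \<noteq> 0"
        using Af by (simp add: product_block_def zero_prod_def outer_self_eq_0)
      have Afp: "cdot (A *v f) p = cdot f (A *v p)" for p by (simp add: cdot_adj' hA)
      show "cdot (1 *s (A *v f)) p + cdot (0 *s (A *v f)) q = 0" if "block_op (A, B, C) (p, q) = 0" for p q
      proof -
        have "cdot f (A *v p + B *v q) = 0" using that by (simp add: block_op_def zero_prod_def)
        moreover have "cdot f (B *v q) = 0" by (simp add: cdot_adj Bf')
        ultimately show ?thesis by (simp add: Afp cdot_add_right cdot_scale_left)
      qed
      show "cdot (cnj 1 *s (A *v f)) p + cdot (cnj 0 *s (A *v f)) q = 0"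
        if "block_op (flip (A, B, C)) (p, q) = 0" for p q
      proof -
        have "cdot f (A *v p + adj B *v q) = 0" using that by (simp add: flip_def block_op_def zero_prod_def)
        moreover have "cdot f (adj B *v q) = 0" by (simp add: cdot_adj Bf)
        ultimately show ?thesis by (simp add: Afp cdot_add_right cdot_scale_left)
      qed
    qed
  next
    case False
    obtain W :: "complex^'n^'n" where W: "C = W ** adj W" using psd_factor[OF psdC] by blast
    have "u = 0" if "adj W *v u = 0" for u
    proof -
      have "C *v u = W *v (adj W *v u)" by (simp add: W matrix_vector_mul_assoc)
      then have "C *v u = 0" by (simp add: that)
      then show ?thesis using False by blast
    qed
    then obtain M where M: "M ** adj W = mat 1" using matrix_left_invertible_ker[of "adj W"] by auto
    then have M': "adj W ** M = mat 1" by (simp only: matrix_left_right_inverse)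
    have WM: "adj M ** W = mat 1" using arg_cong[OF M', of adj] by (simp add: adj_mult)
    have "adj M ** C ** M = (adj M ** W) ** (adj W ** M)" by (simp add: W matrix_mul_assoc)
    then have c: "congr_block M (A, B, C) = (adj M ** A ** M, adj M ** B ** M, mat 1)"
      by (simp add: congr_block_def WM M')
    have "ray (congr_block M (A, B, C))" by (rule ray_congr[OF T M M'])
    then have "congr_block M (A, B, C) \<in> product_blocks" unfolding c by (rule ray_normalized[OF card])
    then have "congr_block (adj W) (congr_block M (A, B, C)) \<in> product_blocks" by (rule congr_product_blocks)
    then show ?thesis by (simp only: congr_block_compose M congr_block_id)
  qed
qed

text \<open>A common kernel vector \<open>f\<close> lets the blocks descend to the quotient by
  \<open>f\<close>, whose dimension is smaller by one.\<close>

lemma joint_kernel_reduce: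
  fixes A :: "complex^'n^'n"
  assumes sep: "\<And>S :: 'm::finite blocks. ppt S \<Longrightarrow> S \<in> convex hull product_blocks"
    and card: "CARD('n) = Suc CARD('m)"
    and T: "ppt (A, B, C)" and f0: "f \<noteq> 0"
    and f: "A *v f = 0" "B *v f = 0" "adj B *v f = 0" "C *v f = 0"
  shows "(A, B, C) \<in> convex hull product_blocks"
proof -
  obtain k where k: "f $ k \<noteq> 0" using f0 by (auto simp: vec_eq_iff)
  have "card (UNIV :: 'm set) = card (UNIV - {k} :: 'n set)" using card by simp
  then obtain g :: "'m \<Rightarrow> 'n" where g: "bij_betw g UNIV (UNIV - {k})"
    using finite_same_card_bij[of "UNIV :: 'm set" "UNIV - {k}"] by auto
  have gk: "g m \<noteq> k" for m using bij_betwE[OF g] by simp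
  have ginj: "g m = g m' \<longleftrightarrow> m = m'" for m m' using bij_betw_imp_inj_on[OF g] by (rule inj_eq)
  \<comment> \<open>\<open>R\<close> projects along \<open>f\<close> onto the vectors with
    coordinate \<open>k\<close> zero and drops that coordinate; \<open>G\<close> puts it back as
    zero. So \<open>G ** R\<close> differs from the identity by multiples of \<open>f\<close>, which
    the blocks do not see.\<close>
  define G :: "complex^'m^'n" where "G = (\<chi> i m. if i = g m then 1 else 0)"
  define R :: "complex^'n^'m" where
    "R = (\<chi> m i. (if i = g m then 1 else 0) - (if i = k then f $ g m / f $ k else 0))"
  have GR: "(G ** R) *v u = u - (u $ k / f $ k) *s f" for u
  proof -
    have R: "(R *v u) $ m = u $ g m - f $ g m / f $ k * u $ k" for m
    proof -
      have "(R *v u) $ m = (\<Sum>i\<in>UNIV. (if i = g m then u $ i else 0) - (if i = k then f $ g m / f $ k * u $ i else 0))"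
        unfolding matrix_vector_mult_def R_def vec_lambda_beta by (rule sum.cong) auto
      then show ?thesis by (simp add: sum_subtractf)
    qed
    have "(G *v (R *v u)) $ i = (u - (u $ k / f $ k) *s f) $ i" for i
    proof (cases "i = k")
      case True
      then show ?thesis using k gk
        by (simp add: G_def matrix_vector_mult_def gk[symmetric])
    next
      case False
      then have "i \<in> g ` UNIV" using bij_betw_imp_surj_on[OF g] by simp
      then obtain m where m: "i = g m" by blast
      have Gm: "G $ i $ m' = (if m' = m then 1 else 0)" for m' by (auto simp: G_def m ginj)
      have "(G *v w) $ i = (\<Sum>m'\<in>UNIV. if m' = m then w $ m' else 0)" for w
        unfolding matrix_vector_mult_def vec_lambda_beta Gm by (rule sum.cong) auto
      then have "(G *v (R *v u)) $ i = (R *v u) $ m" by simp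
      then show ?thesis by (simp add: R m)
    qed
    then show ?thesis by (simp add: vec_eq_iff matrix_vector_mul_assoc)
  qed
  have right: "M ** (G ** R) = M" if "M *v f = 0" for M :: "complex^'n^'n"
    by (rule matrix_ext) (simp add: GR matrix_vector_mult_diff_distrib matrix_vec_scale that
        flip: matrix_vector_mul_assoc[of M])
  have left: "adj (G ** R) ** M = M" if "adj M *v f = 0" for M :: "complex^'n^'n"
    using arg_cong[OF right[OF that], of adj] by (simp add: adj_mult)
  have "adj A = A" "adj C = C" using T by (simp_all add: ppt_def block_psd_def block_herm_def)
  then have "congr_block (G ** R) (A, B, C) = (A, B, C)"
    using f by (simp add: congr_block_def left right)
  moreover have "congr_block R (congr_block G (A, B, C)) \<in> convex hull product_blocks"
    by (intro congr_hull sep ppt_congr T)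
  ultimately show ?thesis by (simp add: congr_block_compose)
qed

text \<open>\<open>f\<close> attains a positive minimum on the compact set of unit vectors in the
  cone, and scaling does the rest.\<close>

lemma closed_cone_bounded:
  fixes K :: "'a::euclidean_space set"
  assumes K: "closed K" and scale: "\<And>x c. x \<in> K \<Longrightarrow> 0 \<le> c \<Longrightarrow> c *\<^sub>R x \<in> K"
    and f: "linear f" and pos: "\<And>x. x \<in> K \<Longrightarrow> x \<noteq> 0 \<Longrightarrow> 0 < (f x :: real)"
  shows "\<exists>M>0. \<forall>x\<in>K. norm x \<le> M * f x"
proof (cases "K \<inter> sphere 0 1 = {}")
  case True
  have "x = 0" if "x \<in> K" for x
  proof (rule ccontr)
    assume "x \<noteq> 0"
    then have "inverse (norm x) *\<^sub>R x \<in> K \<inter> sphere 0 1" using that by (simp add: scale)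
    with True show False by blast
  qed
  then have "\<forall>x\<in>K. norm x \<le> 1 * f x" by (metis f linear_0 mult_1 norm_zero order_refl)
  then show ?thesis using zero_less_one by blast
next
  case False
  have c: "compact (K \<inter> sphere 0 1)" using K by (simp add: closed_Int_compact)
  have "continuous_on (K \<inter> sphere 0 1) f"
    by (intro linear_continuous_on linear_conv_bounded_linear[THEN iffD1] f)
  from continuous_attains_inf[OF c False this]
  obtain z where z: "z \<in> K" "norm z = 1" "\<And>y. y \<in> K \<Longrightarrow> norm y = 1 \<Longrightarrow> f z \<le> f y" by auto
  have fz: "f z > 0" using pos[OF z(1)] z(2) by (metis norm_zero zero_neq_one)
  have "norm x \<le> (1 / f z) * f x" if x: "x \<in> K" for x
  proof (cases "x = 0")
    case False
    have "f z \<le> f (inverse (norm x) *\<^sub>R x)" using False x by (intro z) (auto simp: scale)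
    then have "f z \<le> f x / norm x" by (simp add: linear_scale[OF f] divide_inverse mult.commute)
    then show ?thesis using fz False by (simp add: field_simps)
  qed (simp add: linear_0[OF f])
  then show ?thesis using fz by (intro exI[of _ "1 / f z"]) auto
qed

section \<open>The compact base of the PPT cone and its extreme points\<close>

lemma closed_linear_nonneg: "linear (f :: 'a::euclidean_space \<Rightarrow> real) \<Longrightarrow> closed {x. 0 \<le> f x}"
  by (intro closed_Collect_le continuous_on_const linear_continuous_on linear_conv_bounded_linear[THEN iffD1])

lemma closed_linear_zero: "linear (f :: 'a::euclidean_space \<Rightarrow> 'b::euclidean_space) \<Longrightarrow> closed {x. f x = 0}"
  by (intro closed_Collect_eq continuous_on_const linear_continuous_on linear_conv_bounded_linear[THEN iffD1])

lemma linear_block_op_left: "linear (\<lambda>T. z \<bullet> block_op T z)"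
  by (rule linearI) (simp_all add: block_op_add block_op_scaleR inner_add_right)

lemma linear_flip: "linear flip"
  by (rule linearI) (simp_all add: flip_add flip_scaleR)

lemma closed_ppt: "closed {T :: 'n::finite blocks. ppt T}"
proof -
  have "block_herm T \<longleftrightarrow> (\<lambda>(A, B, C). (A - adj A, C - adj C)) T = 0" for T :: "'n blocks"
    by (cases T) (auto simp: block_herm_def zero_prod_def)
  then have "{T :: 'n blocks. ppt T} = {T. (\<lambda>(A, B, C). (A - adj A, C - adj C)) T = 0} \<inter>
      (\<Inter>z. {T. 0 \<le> z \<bullet> block_op T z}) \<inter> (\<Inter>z. {T. 0 \<le> z \<bullet> block_op (flip T) z})"
    unfolding ppt_def block_psd_def block_herm_flip by blast
  moreover have "closed {T :: 'n blocks. (\<lambda>(A, B, C). (A - adj A, C - adj C)) T = 0}"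
    by (rule closed_linear_zero, rule linearI) (auto simp: adj_add adj_scaleR scaleR_diff_right split: prod.splits)
  moreover have "closed {T :: 'n blocks. 0 \<le> z \<bullet> block_op T z}" for z
    by (intro closed_linear_nonneg linear_block_op_left)
  moreover have "closed {T :: 'n blocks. 0 \<le> z \<bullet> block_op (flip T) z}" for z
    using linear_compose[OF linear_flip linear_block_op_left]
    by (intro closed_linear_nonneg) (simp add: o_def)
  ultimately show ?thesis by (simp only:) (intro closed_Int closed_INT ballI)
qed

lemma convex_ppt_base: "convex {T. ppt T \<and> block_tr T = 1}"
  by (rule convexI) (auto simp: ppt_add ppt_scaleR linear_add[OF linear_block_tr] linear_scale[OF linear_block_tr])

lemma compact_ppt_base: "compact {T :: 'n::finite blocks. ppt T \<and> block_tr T = 1}"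
proof -
  have "\<exists>M>0. \<forall>T\<in>{T :: 'n blocks. ppt T}. norm T \<le> M * block_tr T"
  proof (rule closed_cone_bounded[OF closed_ppt _ linear_block_tr])
    show "0 < block_tr T" if "T \<in> {T. ppt T}" "T \<noteq> 0" for T :: "'n blocks"
      using that block_tr_nonneg[of T] block_tr_eq_0[of T] by (simp add: ppt_def order_less_le) blast
  qed (simp add: ppt_scaleR)
  then obtain M where "\<And>T :: 'n blocks. ppt T \<Longrightarrow> norm T \<le> M * block_tr T" by blast
  then have "bounded {T :: 'n blocks. ppt T \<and> block_tr T = 1}"
    by (intro boundedI[of _ M]) (metis (mono_tags, lifting) mem_Collect_eq mult.right_neutral)
  moreover have "closed ({T :: 'n blocks. ppt T} \<inter> {T. block_tr T = 1})"
    by (intro closed_Int closed_ppt closed_Collect_eq continuous_on_const linear_continuous_on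
        linear_conv_bounded_linear[THEN iffD1] linear_block_tr)
  ultimately show ?thesis by (simp add: compact_eq_bounded_closed Collect_conj_eq)
qed

text \<open>If \<open>Y\<close> has trace \<open>s\<close> strictly between 0 and 1, then
  \<open>T\<close> is a mixture of \<open>Y / s\<close> and \<open>(T - Y) / (1 - s)\<close>, which
  must coincide. For \<open>s = 0\<close> or \<open>s = 1\<close> one of the two summands has trace
  zero and vanishes.\<close>

lemma extreme_point_ray:
  assumes ext: "T extreme_point_of {T. ppt T \<and> block_tr T = 1}"
  shows "ray T"
proof -
  have T: "ppt T" "block_tr T = 1" using ext by (auto simp: extreme_point_of_def)
  have "\<exists>t. Y = t *\<^sub>R T" if Y: "ppt Y" "ppt (T - Y)" for Y
  proof -
    define s where "s = block_tr Y"
    have tr: "block_tr (T - Y) = 1 - s" by (simp add: linear_diff[OF linear_block_tr] T s_def)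
    have s: "0 \<le> s" "0 \<le> 1 - s"
      using Y block_tr_nonneg[of Y] block_tr_nonneg[of "T - Y"] unfolding tr by (simp_all add: ppt_def s_def)
    consider "s = 0" | "s = 1" | "0 < s" "s < 1" using s by linarith
    then show ?thesis
    proof cases
      case 1
      then have "Y = 0" using Y block_tr_eq_0[of Y] by (simp add: s_def ppt_def)
      then show ?thesis by (intro exI[of _ 0]) simp
    next
      case 2
      then have "T - Y = 0" using Y block_tr_eq_0[of "T - Y"] tr by (simp add: ppt_def)
      then show ?thesis by (intro exI[of _ 1]) simp
    next
      case 3
      define P where "P = (1 / s) *\<^sub>R Y"
      define Q where "Q = (1 / (1 - s)) *\<^sub>R (T - Y)"
      have P: "P \<in> {T. ppt T \<and> block_tr T = 1}"
        using 3 Y by (simp add: P_def ppt_scaleR linear_scale[OF linear_block_tr] flip: s_def)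
      have Q: "Q \<in> {T. ppt T \<and> block_tr T = 1}"
        using 3 Y by (simp add: Q_def ppt_scaleR linear_scale[OF linear_block_tr] tr)
      have YP: "Y = s *\<^sub>R P" using 3 by (simp add: P_def)
      have "(1 - s) *\<^sub>R Q = T - Y" using 3 by (simp add: Q_def)
      then have T': "T = (1 - s) *\<^sub>R Q + s *\<^sub>R P" by (simp flip: YP)
      have "T \<notin> open_segment Q P" using ext P Q unfolding extreme_point_of_def by blast
      then have "Q = P" using T' 3 unfolding in_segment by blast
      then have "T = P" using T' by (simp flip: scaleR_add_left)
      then show ?thesis using YP by blast
    qed
  qed
  moreover have "T \<noteq> 0" using T(2) linear_0[OF linear_block_tr] by (metis zero_neq_one)
  ultimately show ?thesis using T(1) unfolding ray_def by blast
qed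

lemma product_hull_scale:
  assumes "T \<in> convex hull product_blocks" "0 \<le> c"
  shows "c *\<^sub>R T \<in> convex hull product_blocks"
proof -
  have "cone (product_blocks :: 'a blocks set)" unfolding cone_def using product_blocks_scale by blast
  then have "cone (convex hull (product_blocks :: 'a blocks set))" by (rule cone_convex_hull)
  then show ?thesis using assms unfolding cone_def by blast
qed

lemma ppt_separable_if_rays:
  fixes T :: "'n::finite blocks"
  assumes rays: "\<And>T :: 'n blocks. ray T \<Longrightarrow> T \<in> convex hull product_blocks" and T: "ppt T"
  shows "T \<in> convex hull product_blocks"
proof (cases "T = 0")
  case True
  have "0 = product_block 0 0 (0 :: complex^'n)" by (simp add: product_block_def zero_prod_def vec_eq_iff)
  then have "0 \<in> (product_blocks :: 'n blocks set)" unfolding product_blocks_def by blast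
  then show ?thesis using True by (simp add: hull_inc)
next
  case False
  define t where "t = block_tr T"
  have t: "t > 0" using False T block_tr_nonneg[of T] block_tr_eq_0[of T]
    by (auto simp: t_def ppt_def order_less_le)
  define S where "S = {T :: 'n blocks. ppt T \<and> block_tr T = 1}"
  have "(1 / t) *\<^sub>R T \<in> S"
    using t T by (simp add: S_def ppt_scaleR linear_scale[OF linear_block_tr] flip: t_def)
  also have "S = convex hull {x. x extreme_point_of S}"
    unfolding S_def by (rule Krein_Milman_Minkowski[OF compact_ppt_base convex_ppt_base])
  also have "\<dots> \<subseteq> convex hull product_blocks"
  proof (rule hull_minimal)
    show "{x. x extreme_point_of S} \<subseteq> convex hull product_blocks"
      unfolding S_def using rays extreme_point_ray by blast
  qed simp
  finally have "t *\<^sub>R (1 / t) *\<^sub>R T \<in> convex hull product_blocks"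
    by (rule product_hull_scale) (use t in simp)
  then show ?thesis using t by simp
qed

text \<open>The dimension is part of the type, so the induction on it is unrolled: this is the
  inductive step, with the descent left as the assumption \<open>joint\<close>. The types
  \<open>unit\<close> and \<open>bool\<close> then serve as the index sets of sizes 1 and 2.\<close>

lemma ppt_separable_if_joint_kernel:
  fixes T :: "'n::finite blocks"
  assumes card: "CARD('n) \<le> 3" and T: "ppt T"
    and joint: "\<And>A B C f. ppt (A, B, C) \<Longrightarrow> f \<noteq> 0 \<Longrightarrow> A *v f = 0 \<Longrightarrow> B *v f = 0 \<Longrightarrow>
      adj B *v f = 0 \<Longrightarrow> C *v f = (0 :: complex^'n) \<Longrightarrow> (A, B, C) \<in> convex hull product_blocks"
  shows "T \<in> convex hull product_blocks"
proof (rule ppt_separable_if_rays[OF _ T])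
  fix T :: "'n blocks"
  assume T: "ray T"
  obtain A B C where ABC: "T = (A, B, C)" by (cases T)
  show "T \<in> convex hull product_blocks"
  proof (cases "\<exists>f. f \<noteq> 0 \<and> A *v f = 0 \<and> B *v f = 0 \<and> adj B *v f = 0 \<and> C *v f = 0")
    case True
    then show ?thesis using joint T unfolding ABC ray_def by blast
  next
    case False
    then have "(A, B, C) \<in> product_blocks" using ray_no_joint_kernel[OF card] T unfolding ABC by blast
    then show ?thesis unfolding ABC by (rule hull_inc)
  qed
qed

lemma ppt_separable_1:
  fixes T :: "'n::finite blocks"
  assumes card: "CARD('n) = 1" and T: "ppt T"
  shows "T \<in> convex hull product_blocks"
proof (rule ppt_separable_if_joint_kernel[OF _ T])
  show "CARD('n) \<le> 3" using card by simp
  fix A B C :: "complex^'n^'n" and f :: "complex^'n"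
  assume f: "f \<noteq> 0" "A *v f = 0" "B *v f = 0" "adj B *v f = 0" "C *v f = 0"
  obtain k where k: "(UNIV :: 'n set) = {k}" using card by (auto simp: card_1_singleton_iff)
  have i: "i = k" for i :: 'n using k by auto
  have fk: "f $ k \<noteq> 0" using f(1) by (metis i vec_eq_iff zero_index)
  have "M = 0" if "M *v f = 0" for M :: "complex^'n^'n"
  proof -
    have "(M *v f) $ k = M $ k $ k * f $ k" by (simp add: matrix_vector_mult_def k)
    then have "M $ k $ k = 0" using that fk by simp
    then show ?thesis by (metis i vec_eq_iff zero_index)
  qed
  then have "(A, B, C) = product_block 0 0 f"
    using f by (simp add: product_block_def vec_eq_iff)
  then show "(A, B, C) \<in> convex hull product_blocks"
    by (metis (mono_tags, lifting) hull_inc mem_Collect_eq product_blocks_def)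
qed

lemma ppt_separable_2:
  fixes T :: "'n::finite blocks"
  assumes card: "CARD('n) = 2" and T: "ppt T"
  shows "T \<in> convex hull product_blocks"
proof (rule ppt_separable_if_joint_kernel[OF _ T])
  show "CARD('n) \<le> 3" using card by simp
  fix A B C :: "complex^'n^'n" and f
  assume *: "ppt (A, B, C)" "f \<noteq> 0" "A *v f = 0" "B *v f = 0" "adj B *v f = 0" "C *v f = 0"
  show "(A, B, C) \<in> convex hull product_blocks"
  proof (rule joint_kernel_reduce[OF _ _ *])
    show "S \<in> convex hull product_blocks" if "ppt S" for S :: "unit blocks"
      by (rule ppt_separable_1[OF _ that]) simp
  qed (simp add: card)
qed

theorem ppt_separable:
  fixes T :: "'n::finite blocks"
  assumes card: "CARD('n) \<le> 3" and T: "ppt T"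
  shows "T \<in> convex hull product_blocks"
proof -
  have "CARD('n) > 0" by simp
  with card consider "CARD('n) = 1" | "CARD('n) = 2" | "CARD('n) = 3" by linarith
  then show ?thesis
  proof cases
    case 3
    show ?thesis
    proof (rule ppt_separable_if_joint_kernel[OF card T])
      fix A B C :: "complex^'n^'n" and f
      assume *: "ppt (A, B, C)" "f \<noteq> 0" "A *v f = 0" "B *v f = 0" "adj B *v f = 0" "C *v f = 0"
      show "(A, B, C) \<in> convex hull product_blocks"
      proof (rule joint_kernel_reduce[OF _ _ *])
        show "S \<in> convex hull product_blocks" if "ppt S" for S :: "bool blocks"
          by (rule ppt_separable_2[OF _ that]) simp
      qed (simp add: 3)
    qed
  qed (use ppt_separable_1 ppt_separable_2 T in blast)+
qed

subsection \<open>Small bipartite systems\<close>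

text \<open>As the generators are not normalised, this convex hull is already a cone.\<close>

definition separable :: "('a::finite \<times> 'b::finite) cmat set" where
  "separable = convex hull {kron (outer u u) (outer v v) | u v. True}"

definition cnj_vec :: "complex^'n \<Rightarrow> complex^'n" where
  "cnj_vec u = (\<chi> i. cnj (u $ i))"

lemma cnj_vec_inner: "cnj_vec u \<bullet> cnj_vec v = u \<bullet> v"
  by (simp add: cnj_vec_def inner_vec_def inner_complex_def)

lemma cnj_vec_add: "cnj_vec u + cnj_vec v = cnj_vec (u + v)"
  by (simp add: cnj_vec_def vec_eq_iff)

lemma transpose_mult_cnj_vec: "transpose M *v cnj_vec u = cnj_vec (adj M *v u)"
  by (simp add: cnj_vec_def vec_eq_iff matrix_vector_mult_def transpose_def)

lemma adj_transpose_mult_cnj_vec: "adj (transpose M) *v cnj_vec u = cnj_vec (M *v u)"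
  by (simp add: cnj_vec_def vec_eq_iff matrix_vector_mult_def transpose_def)

lemma adj_transpose_eq: "adj M = M \<Longrightarrow> adj (transpose M) = transpose M"
  by (simp add: vec_eq_iff transpose_def)

lemma psd_transpose: "psd M \<Longrightarrow> psd (transpose M)"
proof -
  assume M: "psd M"
  have "v \<bullet> (transpose M *v v) = cnj_vec v \<bullet> (M *v cnj_vec v)" for v
  proof -
    have "v = cnj_vec (cnj_vec v)" by (simp add: cnj_vec_def vec_eq_iff)
    then have "v \<bullet> (transpose M *v v) = cnj_vec (cnj_vec v) \<bullet> (transpose M *v cnj_vec (cnj_vec v))" by simp
    also have "\<dots> = cnj_vec v \<bullet> (M *v cnj_vec v)"
      using M by (simp add: transpose_mult_cnj_vec cnj_vec_inner psd_iff del: transpose_matrix_vector)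
    finally show ?thesis .
  qed
  then show ?thesis using M by (simp add: psd_iff adj_transpose_eq)
qed

text \<open>For Hermitian \<open>A\<close> and \<open>C\<close> the triple
  \<open>(A, adj B, C)\<close> is the entrywise complex conjugate of the transposed triple, and
  conjugating all entries preserves positivity.\<close>

lemma block_psd_transpose:
  assumes T: "block_psd (transpose A, transpose B, transpose C)" and h: "adj A = A" "adj C = C"
  shows "block_psd (A, adj B, C)"
proof -
  have "0 \<le> (u, v) \<bullet> block_op (A, adj B, C) (u, v)" for u v
  proof -
    have "block_op (transpose A, transpose B, transpose C) (cnj_vec u, cnj_vec v) =
        (cnj_vec (A *v u + adj B *v v), cnj_vec (B *v u + C *v v))"
      by (simp add: block_op_def transpose_mult_cnj_vec adj_transpose_mult_cnj_vec h cnj_vec_add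
          del: transpose_matrix_vector)
    moreover have "0 \<le> (cnj_vec u, cnj_vec v) \<bullet>
        block_op (transpose A, transpose B, transpose C) (cnj_vec u, cnj_vec v)"
      using T by (simp only: block_psd_def)
    ultimately show ?thesis by (simp add: cnj_vec_inner block_op_def)
  qed
  then show ?thesis by (auto simp: block_psd_def block_herm_def h)
qed

lemma sum_pair_2:
  fixes f :: "'a::finite \<times> 'b::finite \<Rightarrow> 'c::comm_monoid_add"
  assumes "a1 \<noteq> a2" "(UNIV :: 'a set) = {a1, a2}"
  shows "(\<Sum>p\<in>UNIV. f p) = (\<Sum>j\<in>UNIV. f (a1, j)) + (\<Sum>j\<in>UNIV. f (a2, j))"
proof -
  have "(\<Sum>p\<in>UNIV. f p) = (\<Sum>i\<in>UNIV. \<Sum>j\<in>UNIV. f (i, j))"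
    by (simp add: sum.cartesian_product)
  also have "\<dots> = (\<Sum>j\<in>UNIV. f (a1, j)) + (\<Sum>j\<in>UNIV. f (a2, j))"
    unfolding assms(2) using assms(1) by simp
  finally show ?thesis .
qed

lemma block_psd_of_psd:
  fixes X :: "('a::finite \<times> 'b::finite) cmat"
  assumes a: "a1 \<noteq> a2" "(UNIV :: 'a set) = {a1, a2}" and X: "psd X"
  shows "block_psd (\<chi> i j. X $ (a1, i) $ (a1, j), \<chi> i j. X $ (a1, i) $ (a2, j), \<chi> i j. X $ (a2, i) $ (a2, j))"
    (is "block_psd (?A, ?B, ?C)")
proof -
  have herm: "cnj (X $ p $ q) = X $ q $ p" for p q
    using X by (metis adj_nth psd_iff)
  have "0 \<le> (u, v) \<bullet> block_op (?A, ?B, ?C) (u, v)" for u v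
  proof -
    define w :: "complex^('a \<times> 'b)" where "w = (\<chi> p. if fst p = a1 then u $ snd p else v $ snd p)"
    have w: "w $ (a1, j) = u $ j" "w $ (a2, j) = v $ j" for j using a(1) by (simp_all add: w_def)
    have "(X *v w) $ (a1, i) = (?A *v u + ?B *v v) $ i" "(X *v w) $ (a2, i) = (adj ?B *v u + ?C *v v) $ i" for i
      by (simp_all add: matrix_vector_mult_def sum_pair_2[OF a] w herm)
    then have "w \<bullet> (X *v w) = (u, v) \<bullet> block_op (?A, ?B, ?C) (u, v)"
      unfolding inner_vec_def[of w] sum_pair_2[OF a] w by (simp add: block_op_def inner_vec_def)
    then show ?thesis using X by (metis psd_iff)
  qed
  moreover have "adj ?A = ?A" "adj ?C = ?C" by (simp_all add: vec_eq_iff herm)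
  ultimately show ?thesis by (auto simp: block_psd_def block_herm_def)
qed

lemma ppt_separable_2_n:
  fixes X :: "('a::finite \<times> 'b::finite) cmat"
  assumes "CARD('a) = 2" "CARD('b) \<le> 3" and X: "psd X" "psd (ptranspose_B X)"
  shows "X \<in> separable"
proof -
  obtain a1 a2 :: 'a where a: "a1 \<noteq> a2" "(UNIV :: 'a set) = {a1, a2}"
    using assms(1) by (auto simp: card_2_iff)
  define A :: "complex^'b^'b" where "A = (\<chi> i j. X $ (a1, i) $ (a1, j))"
  define B :: "complex^'b^'b" where "B = (\<chi> i j. X $ (a1, i) $ (a2, j))"
  define C :: "complex^'b^'b" where "C = (\<chi> i j. X $ (a2, i) $ (a2, j))"
  have herm: "cnj (X $ p $ q) = X $ q $ p" for p q
    using X(1) by (metis adj_nth psd_iff)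
  have T1: "block_psd (A, B, C)" unfolding A_def B_def C_def by (rule block_psd_of_psd[OF a X(1)])
  have "block_psd (transpose A, transpose B, transpose C)"
    using block_psd_of_psd[OF a X(2)] by (simp add: A_def B_def C_def transpose_def ptranspose_B_def)
  then have "block_psd (A, adj B, C)"
    by (rule block_psd_transpose) (use T1 in \<open>simp_all add: block_psd_def block_herm_def\<close>)
  with T1 have "ppt (A, B, C)" by (simp add: ppt_def flip_def)
  then have T: "(A, B, C) \<in> convex hull product_blocks" by (rule ppt_separable[OF assms(2)])
  \<comment> \<open>\<open>F\<close> reassembles the bipartite matrix from its blocks. It is only
    real-linear, because of \<open>adj B\<close>, but that suffices to carry convex hulls to convex
    hulls.\<close>
  define F :: "'b blocks \<Rightarrow> ('a \<times> 'b) cmat" where "F = (\<lambda>(A, B, C). \<chi> p q.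
    (if fst p = a1 then (if fst q = a1 then A else B) else (if fst q = a1 then adj B else C)) $ snd p $ snd q)"
  have F: "linear F"
    by (rule linearI) (auto simp: F_def vec_eq_iff)
  have el: "i = a2" if "i \<noteq> a1" for i using a(2) that by auto
  have "F (A, B, C) = X"
    by (auto simp: F_def vec_eq_iff A_def B_def C_def herm dest!: el)
  moreover have "F ` product_blocks \<subseteq> {kron (outer u u) (outer v v) | u v. True}"
  proof clarify
    fix P :: "'b blocks" assume "P \<in> product_blocks"
    then obtain x y v where P: "P = product_block x y v" unfolding product_blocks_def by blast
    define u :: "complex^'a" where "u = (\<chi> i. if i = a1 then x else y)"
    have "F P = kron (outer u u) (outer v v)"
      by (simp add: F_def P product_block_def vec_eq_iff kron_def u_def mult_ac)
    then show "\<exists>u v. F P = kron (outer u u) (outer v v) \<and> True" by blast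
  qed
  ultimately show ?thesis
    using T convex_hull_linear_image[OF F, of product_blocks] hull_mono unfolding separable_def by blast
qed

definition swap_AB :: "('a::finite \<times> 'b::finite) cmat \<Rightarrow> ('b \<times> 'a) cmat" where
  "swap_AB X = (\<chi> p q. X $ (snd p, fst p) $ (snd q, fst q))"

lemma psd_swap_AB:
  fixes X :: "('a::finite \<times> 'b::finite) cmat"
  assumes X: "psd X" shows "psd (swap_AB X)"
proof -
  have sw: "(\<Sum>p\<in>UNIV. f p) = (\<Sum>p\<in>UNIV. f (prod.swap p))" for f :: "'b \<times> 'a \<Rightarrow> 'c::comm_monoid_add"
    by (rule sum.reindex_bij_betw[symmetric]) (simp add: bij_swap)
  have "0 \<le> v \<bullet> (swap_AB X *v v)" for v
  proof -
    define w :: "complex^('a \<times> 'b)" where "w = (\<chi> p. v $ prod.swap p)"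
    have "(swap_AB X *v v) $ prod.swap p = (X *v w) $ p" for p
      unfolding matrix_vector_mult_def vec_lambda_beta sw by (simp add: swap_AB_def w_def)
    then have "v \<bullet> (swap_AB X *v v) = w \<bullet> (X *v w)"
      unfolding inner_vec_def[of v] sw by (simp add: inner_vec_def w_def)
    then show ?thesis using X by (simp add: psd_iff)
  qed
  moreover have "adj (swap_AB X) = swap_AB X"
    using X by (simp add: vec_eq_iff psd_iff swap_AB_def)
  ultimately show ?thesis by (simp add: psd_iff)
qed

lemma swap_AB_separable:
  fixes X :: "('a::finite \<times> 'b::finite) cmat"
  assumes "X \<in> separable" shows "swap_AB X \<in> separable"
proof -
  have lin: "linear swap_AB" by (rule linearI) (simp_all add: swap_AB_def vec_eq_iff)
  have "swap_AB (kron (outer u u) (outer v v)) = kron (outer v v) (outer u u)"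
    for u :: "complex^'a" and v :: "complex^'b"
    by (simp add: swap_AB_def kron_def vec_eq_iff mult_ac)
  then have "swap_AB ` {kron (outer u u) (outer v v) | (u :: complex^'a) (v :: complex^'b). True} \<subseteq>
      {kron (outer v v) (outer u u) | v u. True}"
    by blast
  then show ?thesis
    using assms convex_hull_linear_image[OF lin] hull_mono unfolding separable_def by blast
qed

text \<open>After exchanging the factors the transpose falls on the former \<open>A\<close>. A
  transpose on \<open>A\<close> is one on \<open>B\<close> followed by the full transpose, which
  preserves positivity.\<close>

lemma ppt_separable_n_2:
  fixes X :: "('a::finite \<times> 'b::finite) cmat"
  assumes "CARD('b) = 2" "CARD('a) \<le> 3" and X: "psd X" "psd (ptranspose_B X)"
  shows "X \<in> separable"
proof -
  have "ptranspose_B (swap_AB X) = swap_AB (transpose (ptranspose_B X))"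
    by (simp add: vec_eq_iff ptranspose_B_def swap_AB_def transpose_def)
  then have "psd (ptranspose_B (swap_AB X))"
    using X(2) by (simp add: psd_swap_AB psd_transpose)
  then have "swap_AB X \<in> separable"
    by (intro ppt_separable_2_n assms psd_swap_AB X)
  then have "swap_AB (swap_AB X) \<in> separable" by (rule swap_AB_separable)
  then show ?thesis by (simp add: swap_AB_def)
qed

lemma separable_sum:
  fixes f :: "'i \<Rightarrow> ('a::finite \<times> 'b::finite) cmat"
  assumes "finite I" "\<And>i. i \<in> I \<Longrightarrow> f i \<in> separable"
  shows "(\<Sum>i\<in>I. f i) \<in> separable"
proof -
  let ?G = "{kron (outer u u) (outer v v) | (u :: complex^'a) (v :: complex^'b). True}"
  have "cone ?G"
    unfolding cone_def
  proof clarify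
    fix c :: real and u :: "complex^'a" and v :: "complex^'b" assume c: "0 \<le> c"
    have "complex_of_real (sqrt c) * complex_of_real (sqrt c) = complex_of_real c"
      using c by (metis of_real_mult real_sqrt_mult_self abs_of_nonneg)
    then have "c *\<^sub>R kron (outer u u) (outer v v) =
        kron (outer (complex_of_real (sqrt c) *s u) (complex_of_real (sqrt c) *s u)) (outer v v)"
      by (simp add: kron_def vec_eq_iff scaleR_conv_of_real[where 'a=complex] mult_ac)
    then show "\<exists>u' v'. c *\<^sub>R kron (outer u u) (outer v v) = kron (outer u' u') (outer v' v') \<and> True" by blast
  qed
  then have cone: "cone (separable :: ('a \<times> 'b) cmat set)" unfolding separable_def by (rule cone_convex_hull)
  have conv: "convex (separable :: ('a \<times> 'b) cmat set)" unfolding separable_def by (rule convex_convex_hull)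
  have "kron (outer 0 0) (outer 0 0) \<in> ?G" by blast
  then have "kron (outer 0 0) (outer 0 0) \<in> (separable :: ('a \<times> 'b) cmat set)"
    unfolding separable_def by (rule hull_inc)
  moreover have "kron (outer 0 0) (outer 0 0) = (0 :: ('a \<times> 'b) cmat)" by (simp add: kron_def vec_eq_iff)
  ultimately have z: "0 \<in> (separable :: ('a \<times> 'b) cmat set)" by simp
  show ?thesis
    using assms
  proof (induction I)
    case (insert i I)
    then have "f i \<in> separable" "(\<Sum>i\<in>I. f i) \<in> separable" by auto
    then show ?case
      using insert.hyps iffD1[OF convex_cone conjI[OF conv cone]] by simp
  qed (simp add: z)
qed

text \<open>This serves the case of a one-dimensional factor: the columns of any \<open>W\<close>
  with \<open>X = W ** adj W\<close> are product vectors and decompose \<open>X\<close>.\<close>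

lemma psd_separable_if_vectors_product:
  fixes X :: "('a::finite \<times> 'b::finite) cmat"
  assumes X: "psd X" and prod: "\<And>w :: complex^('a \<times> 'b). \<exists>u v. w = (\<chi> p. u $ fst p * v $ snd p)"
  shows "X \<in> separable"
proof -
  obtain W :: "('a \<times> 'b) cmat" where W: "X = W ** adj W" using psd_factor[OF X] by blast
  have "X = (\<Sum>k\<in>UNIV. outer (\<chi> i. W $ i $ k) (\<chi> i. W $ i $ k))"
    by (simp add: W vec_eq_iff matrix_matrix_mult_def)
  moreover have "outer w w \<in> separable" for w :: "complex^('a \<times> 'b)"
  proof -
    obtain u v where w: "w = (\<chi> p. u $ fst p * v $ snd p)" using prod by blast
    have "outer w w = kron (outer u u) (outer v v)" by (simp add: w kron_def vec_eq_iff mult_ac)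
    then show ?thesis unfolding separable_def by (intro hull_inc) blast
  qed
  ultimately show ?thesis by (simp add: separable_sum)
qed

lemma stormer_woronowicz:
  fixes X :: "('a::finite \<times> 'b::finite) cmat"
  assumes card: "CARD('a) * CARD('b) \<le> 6" and X: "psd X" "psd (ptranspose_B X)"
  shows "X \<in> separable"
proof -
  have pos: "CARD('a) > 0" "CARD('b) > 0" by simp_all
  consider "CARD('a) = 1" | "CARD('b) = 1" | "CARD('a) = 2" "CARD('b) \<le> 3" | "CARD('b) = 2" "CARD('a) \<le> 3"
  proof -
    have "CARD('a) \<le> 2 \<or> CARD('b) \<le> 2"
    proof (rule ccontr)
      assume "\<not> ?thesis"
      then have "3 * 3 \<le> CARD('a) * CARD('b)" by (intro mult_le_mono) auto
      with card show False by simp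
    qed
    moreover have "CARD('b) \<le> 3" if "CARD('a) = 2" using card that by simp
    moreover have "CARD('a) \<le> 3" if "CARD('b) = 2" using card that by simp
    ultimately show thesis using that pos by linarith
  qed
  then show ?thesis
  proof cases
    case 1
    then obtain a where a: "(UNIV :: 'a set) = {a}" by (auto simp: card_1_singleton_iff)
    have "p = (a, snd p)" for p :: "'a \<times> 'b" using a by (cases p) auto
    then have "w = (\<chi> p. (\<chi> i. 1) $ fst p * (\<chi> j. w $ (a, j)) $ snd p)" for w :: "complex^('a \<times> 'b)"
      by (simp add: vec_eq_iff)
    then show ?thesis by (intro psd_separable_if_vectors_product X(1)) blast
  next
    case 2
    then obtain b where b: "(UNIV :: 'b set) = {b}" by (auto simp: card_1_singleton_iff)
    have "p = (fst p, b)" for p :: "'a \<times> 'b" using b by (cases p) auto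
    then have "w = (\<chi> p. (\<chi> i. w $ (i, b)) $ fst p * (\<chi> j. 1) $ snd p)" for w :: "complex^('a \<times> 'b)"
      by (simp add: vec_eq_iff)
    then show ?thesis by (intro psd_separable_if_vectors_product X(1)) blast
  next
    case 3
    then show ?thesis by (rule ppt_separable_2_n[OF _ _ X])
  next
    case 4
    then show ?thesis by (rule ppt_separable_n_2[OF _ _ X])
  qed
qed

subsection \<open>One-way fidelity\<close>

lemma psd_mat_1: "psd (mat 1)"
  using psd_mult_adj[of "mat 1"] by simp

text \<open>The Kronecker product of \<open>V\<close> and \<open>W\<close> factorises that of
  \<open>V ** adj V\<close> and \<open>W ** adj W\<close>.\<close>

lemma psd_kron:
  fixes M :: "'a::finite cmat" and N :: "'b::finite cmat"
  assumes "psd M" "psd N"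
  shows "psd (kron M N)"
proof -
  obtain V :: "'a cmat" where V: "M = V ** adj V" using psd_factor[OF assms(1)] by blast
  obtain W :: "'b cmat" where W: "N = W ** adj W" using psd_factor[OF assms(2)] by blast
  have "kron M N = kron V W ** adj (kron V W)"
    by (simp add: V W vec_eq_iff kron_def matrix_matrix_mult_def sum_product sum.cartesian_product
        case_prod_beta mult_ac)
  then show ?thesis using psd_mult_adj by metis
qed

lemma ptranspose_kron: "ptranspose_B (kron M N) = kron M (transpose N)"
  by (simp add: vec_eq_iff ptranspose_B_def kron_def transpose_def)

lemma ptrace_kron: "ptrace_B (kron M N) = (\<chi> i j. M $ i $ j * trace N)"
  by (simp add: vec_eq_iff ptrace_B_def kron_def trace_def sum_distrib_left)

lemma linear_ptranspose_B: "linear ptranspose_B"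
  by (rule linearI) (simp_all add: ptranspose_B_def vec_eq_iff)

lemma linear_ptrace_B: "linear ptrace_B"
  by (rule linearI) (simp_all add: ptrace_B_def vec_eq_iff sum.distrib scaleR_sum_right)

lemma linear_Re_trace_mult: "linear (\<lambda>X. Re (trace (X ** \<rho>)))"
  for \<rho> :: "complex^'n^'n"
  by (rule linearI) (simp_all add: matrix_add_rdistrib trace_add matrix_mult_scaleR_left trace_def sum_distrib_left sum.distrib)

lemma quantum_state_maximally_mixed: "quantum_state ((1 / real CARD('b)) *\<^sub>R (mat 1 :: 'b::finite cmat))"
proof -
  have "trace ((1 / real CARD('b)) *\<^sub>R (mat 1 :: 'b cmat)) = (1 / real CARD('b)) *\<^sub>R of_nat CARD('b)"
    by (simp add: trace_def mat_def)
  also have "\<dots> = 1" by (simp add: scaleR_conv_of_real)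
  finally show ?thesis by (simp add: quantum_state_def psd_scaleR psd_mat_1)
qed

lemma quantum_state_outer:
  assumes "v \<noteq> 0" shows "quantum_state ((1 / norm v ^ 2) *\<^sub>R outer v v)"
proof -
  have "trace ((1 / norm v ^ 2) *\<^sub>R outer v v) = (1 / norm v ^ 2) *\<^sub>R trace (outer v v)"
    by (simp add: trace_def scaleR_sum_right)
  also have "\<dots> = 1" using assms by (simp add: trace_outer cdot_self scaleR_conv_of_real)
  finally show ?thesis by (simp add: quantum_state_def psd_scaleR psd_outer)
qed

text \<open>The inclusion valid in every dimension: the partial transpose of a sum of products only
  transposes the states, which remain positive.\<close>

lemma one_way_subset_ppt:
  fixes \<rho> :: "('a::finite \<times> 'b::finite) cmat"
  shows "one_way_values \<rho> \<subseteq> ppt_values \<rho>"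
proof
  fix r assume "r \<in> one_way_values \<rho>"
  then obtain n and M :: "nat \<Rightarrow> 'a cmat" and \<mu> :: "nat \<Rightarrow> 'b cmat"
    where r: "r = (\<Sum>i<n. Re (trace (kron (M i) (\<mu> i) ** \<rho>)))"
    and M: "\<And>i. i < n \<Longrightarrow> psd (M i)" "(\<Sum>i<n. M i) = mat 1"
    and mu: "\<And>i. i < n \<Longrightarrow> psd (\<mu> i)" "\<And>i. i < n \<Longrightarrow> trace (\<mu> i) = 1"
    unfolding one_way_values_def povm_def quantum_state_def by blast
  define X where "X = (\<Sum>i<n. kron (M i) (\<mu> i))"
  have "psd X" unfolding X_def by (intro psd_sum psd_kron M mu) auto
  moreover have "psd (ptranspose_B X)"
    unfolding X_def linear_sum[OF linear_ptranspose_B] ptranspose_kron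
    by (intro psd_sum psd_kron psd_transpose M mu) auto
  moreover have "ptrace_B X = (\<Sum>i<n. M i)"
    unfolding X_def linear_sum[OF linear_ptrace_B] by (rule sum.cong) (simp_all add: ptrace_kron mu vec_eq_iff)
  moreover have "r = Re (trace (X ** \<rho>))"
    unfolding r X_def by (rule linear_sum[OF linear_Re_trace_mult, symmetric])
  ultimately show "r \<in> ppt_values \<rho>" unfolding ppt_values_def using M(2) by auto
qed

text \<open>In each product term the weight and the squared norm of \<open>v\<close> go into
  \<open>M i\<close>, so that the other factor has trace one. The partial trace then turns
  \<open>X\<close> into the sum of the \<open>M i\<close>.\<close>

lemma separable_one_way:
  fixes X :: "('a::finite \<times> 'b::finite) cmat"
  assumes X: "X \<in> separable" and tr: "ptrace_B X = mat 1"
  shows "\<exists>n M \<mu>. povm n M \<and> (\<forall>i<n. quantum_state (\<mu> i)) \<and> X = (\<Sum>i<n. kron (M i) (\<mu> i))"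
proof -
  obtain n and c :: "nat \<Rightarrow> real" and x :: "nat \<Rightarrow> ('a \<times> 'b) cmat"
    where cx: "\<forall>i\<in>{1..n}. 0 \<le> c i \<and> (\<exists>u v. x i = kron (outer u u) (outer v v) \<and> True)"
    and X: "(\<Sum>i = 1..n. c i *\<^sub>R x i) = X"
    using X unfolding separable_def convex_hull_indexed mem_Collect_eq by (elim exE conjE) rule
  have c: "0 \<le> c i" if "i \<in> {1..n}" for i using cx that by blast
  have "\<forall>i\<in>{1..n}. \<exists>w. x i = kron (outer (fst w) (fst w)) (outer (snd w) (snd w))"
    using cx by fastforce
  then obtain w where w: "\<forall>i\<in>{1..n}. x i = kron (outer (fst (w i)) (fst (w i))) (outer (snd (w i)) (snd (w i)))"
    by (rule bchoice[THEN exE])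
  define u where "u i = fst (w i)" for i
  define v where "v i = snd (w i)" for i
  have uv: "x i = kron (outer (u i) (u i)) (outer (v i) (v i))" if "i \<in> {1..n}" for i
    using w that by (simp add: u_def v_def)
  \<comment> \<open>The convex combination is indexed by \<open>1..n\<close> and the POVM by
    \<open>i < n\<close>, hence the shift by \<open>Suc\<close>.\<close>
  define M where "M i = (c (Suc i) * norm (v (Suc i)) ^ 2) *\<^sub>R outer (u (Suc i)) (u (Suc i))" for i
  \<comment> \<open>For \<open>v = 0\<close> any state will do, since \<open>M i\<close> then
    carries the factor zero.\<close>
  define \<mu> where "\<mu> i = (if v (Suc i) = 0 then (1 / real CARD('b)) *\<^sub>R mat 1
    else (1 / norm (v (Suc i)) ^ 2) *\<^sub>R outer (v (Suc i)) (v (Suc i)))" for i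
  have mu: "quantum_state (\<mu> i)" for i
    by (simp add: \<mu>_def quantum_state_maximally_mixed quantum_state_outer)
  have psd: "psd (M i)" if "i < n" for i
    unfolding M_def using that by (intro psd_scaleR psd_outer mult_nonneg_nonneg c) auto
  have "(\<Sum>i = 1..n. c i *\<^sub>R x i) = (\<Sum>i<n. c (Suc i) *\<^sub>R x (Suc i))"
    by (rule sum.reindex_bij_witness[of _ Suc "\<lambda>i. i - 1"]) auto
  also have "\<dots> = (\<Sum>i<n. kron (M i) (\<mu> i))"
  proof (rule sum.cong)
    fix i assume "i \<in> {..<n}"
    then have xi: "x (Suc i) = kron (outer (u (Suc i)) (u (Suc i))) (outer (v (Suc i)) (v (Suc i)))"
      by (intro uv) auto
    show "c (Suc i) *\<^sub>R x (Suc i) = kron (M i) (\<mu> i)"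
      by (cases "v (Suc i) = 0")
        (simp_all add: xi M_def \<mu>_def kron_def vec_eq_iff scaleR_conv_of_real[where 'a=complex])
  qed simp
  finally have eq: "X = (\<Sum>i<n. kron (M i) (\<mu> i))" unfolding X .
  have "(\<Sum>i<n. M i) = (\<Sum>i<n. ptrace_B (kron (M i) (\<mu> i)))"
    using mu by (intro sum.cong) (simp_all add: ptrace_kron quantum_state_def vec_eq_iff)
  also have "\<dots> = mat 1" using tr unfolding eq linear_sum[OF linear_ptrace_B] .
  finally have "povm n M" using psd unfolding povm_def by blast
  then show ?thesis
    using mu eq by (intro exI[of _ n] exI[of _ M] exI[of _ \<mu>] conjI allI impI)
qed

lemma ppt_subset_one_way:
  fixes \<rho> :: "('a::finite \<times> 'b::finite) cmat"
  assumes "CARD('a) * CARD('b) \<le> 6"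
  shows "ppt_values \<rho> \<subseteq> one_way_values \<rho>"
proof
  fix r assume "r \<in> ppt_values \<rho>"
  then obtain X where r: "r = Re (trace (X ** \<rho>))" and X: "psd X" "psd (ptranspose_B X)" "ptrace_B X = mat 1"
    unfolding ppt_values_def by blast
  obtain n M \<mu> where "povm n M" "\<forall>i<n. quantum_state (\<mu> i)" and eq: "X = (\<Sum>i<n. kron (M i) (\<mu> i))"
    using separable_one_way[OF stormer_woronowicz[OF assms X(1,2)] X(3)] by blast
  moreover have "r = (\<Sum>i<n. Re (trace (kron (M i) (\<mu> i) ** \<rho>)))"
    unfolding r eq by (rule linear_sum[OF linear_Re_trace_mult])
  ultimately show "r \<in> one_way_values \<rho>" unfolding one_way_values_def by blast
qed

section \<open>Compactness of the feasible set\<close>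

lemma linear_form_left: "linear (\<lambda>X :: complex^'n^'n. v \<bullet> (X *v v))"
  by (rule linearI) (simp_all add: matrix_vector_mult_add_rdistrib inner_add_right scaleR_matrix_vec)

lemma closed_psd: "closed {X :: 'n::finite cmat. psd X}"
proof -
  have "{X :: 'n cmat. psd X} = {X. X - adj X = 0} \<inter> (\<Inter>v. {X. 0 \<le> v \<bullet> (X *v v)})"
    by (auto simp: psd_iff)
  moreover have "closed {X :: 'n cmat. X - adj X = 0}"
    by (rule closed_linear_zero, rule linearI) (simp_all add: adj_add adj_scaleR scaleR_diff_right)
  moreover have "closed {X :: 'n cmat. 0 \<le> v \<bullet> (X *v v)}" for v
    by (intro closed_linear_nonneg linear_form_left)
  ultimately show ?thesis by (simp only:) (intro closed_Int closed_INT ballI)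
qed

lemma psd_trace_nonneg: "psd X \<Longrightarrow> 0 \<le> Re (trace X)"
proof -
  assume "psd X"
  then have "0 \<le> Re (X $ i $ i)" for i
    by (metis Re_cdot cdot_axis(1) matrix_vec_axis psd_iff)
  then show ?thesis by (simp add: trace_def sum_nonneg)
qed

lemma trace_ptrace_B: "trace (ptrace_B X) = trace X"
  by (simp add: trace_def ptrace_B_def sum.cartesian_product)

text \<open>The norm of a positive matrix is at most a constant times its trace, and the trace of
  \<open>X\<close> is fixed by its partial trace; so the feasible set is bounded, and it is closed.
  The product of the identity with the maximally mixed state shows that it is nonempty.\<close>

lemma ppt_values_has_max:
  fixes \<rho> :: "('a::finite \<times> 'b::finite) cmat"
  shows "has_max (ppt_values \<rho>)"
proof -
  define S where "S = {X :: ('a \<times> 'b) cmat. psd X \<and> psd (ptranspose_B X) \<and> ptrace_B X = mat 1}"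
  have linRe: "linear (\<lambda>X :: ('a \<times> 'b) cmat. Re (trace X))"
    using linear_Re_trace_mult[of "mat 1 :: ('a \<times> 'b) cmat"] by simp
  obtain K where K: "\<And>X :: ('a \<times> 'b) cmat. psd X \<Longrightarrow> norm X \<le> K * Re (trace X)"
  proof -
    have "\<exists>K>0. \<forall>X\<in>{X :: ('a \<times> 'b) cmat. psd X}. norm X \<le> K * Re (trace X)"
    proof (rule closed_cone_bounded[OF closed_psd _ linRe])
      show "0 < Re (trace X)" if "X \<in> {X. psd X}" "X \<noteq> 0" for X :: "('a \<times> 'b) cmat"
        using that psd_trace_nonneg[of X] psd_trace_eq_0[of X] by (auto simp: order_less_le)
    qed (simp add: psd_scaleR)
    then show ?thesis using that by blast
  qed
  have "bounded S"
  proof (rule boundedI)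
    fix X assume "X \<in> S"
    then have "norm X \<le> K * Re (trace X)" "ptrace_B X = mat 1" using K by (simp_all add: S_def)
    then show "norm X \<le> K * Re (trace (mat 1 :: 'a cmat))" by (metis trace_ptrace_B)
  qed
  moreover have "closed S"
  proof -
    have cont: "continuous_on UNIV (ptranspose_B :: ('a \<times> 'b) cmat \<Rightarrow> _)"
      "continuous_on UNIV (ptrace_B :: ('a \<times> 'b) cmat \<Rightarrow> _)"
      by (simp_all add: linear_continuous_on linear_conv_bounded_linear[THEN iffD1] linear_ptranspose_B linear_ptrace_B)
    have "S = {X. psd X} \<inter> (ptranspose_B -` {X. psd X}) \<inter> {X. ptrace_B X = mat 1}"
      by (auto simp: S_def)
    moreover have "closed (ptranspose_B -` {X :: ('a \<times> 'b) cmat. psd X})"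
      by (rule closed_vimage[OF closed_psd cont(1)])
    moreover have "closed {X :: ('a \<times> 'b) cmat. ptrace_B X = mat 1}"
      by (intro closed_Collect_eq cont continuous_on_const)
    ultimately show ?thesis using closed_psd by (simp only:) (intro closed_Int)
  qed
  ultimately have "compact S" by (simp add: compact_eq_bounded_closed)
  moreover have "S \<noteq> {}"
  proof -
    define \<mu> where "\<mu> = (1 / real CARD('b)) *\<^sub>R (mat 1 :: 'b cmat)"
    have mu: "psd \<mu>" "trace \<mu> = 1"
      using quantum_state_maximally_mixed[where 'b = 'b] by (simp_all add: quantum_state_def \<mu>_def)
    have "kron (mat 1) \<mu> \<in> S"
      by (simp add: S_def psd_kron psd_mat_1 mu ptranspose_kron psd_transpose ptrace_kron vec_eq_iff)
    then show ?thesis by blast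
  qed
  moreover have "continuous_on S (\<lambda>X. Re (trace (X ** \<rho>)))"
    by (intro linear_continuous_on linear_conv_bounded_linear[THEN iffD1] linear_Re_trace_mult)
  ultimately have "\<exists>X\<in>S. \<forall>Y\<in>S. Re (trace (Y ** \<rho>)) \<le> Re (trace (X ** \<rho>))"
    by (rule continuous_attains_sup)
  moreover have "ppt_values \<rho> = (\<lambda>X. Re (trace (X ** \<rho>))) ` S"
    unfolding ppt_values_def S_def by blast
  ultimately show ?thesis by (simp add: has_max_def)
qed

theorem theorem1:
  fixes \<rho> :: "('a::finite \<times> 'b::finite) cmat"
  assumes "CARD('a) * CARD('b) \<le> 6"
    and "quantum_state \<rho>"
  shows "has_max (one_way_values \<rho>) \<and> has_max (ppt_values \<rho>) \<and>
    one_way_fidelity \<rho> = max_of (ppt_values \<rho>)"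
proof -
  have "one_way_values \<rho> = ppt_values \<rho>"
    using one_way_subset_ppt ppt_subset_one_way[OF assms(1)] by blast
  then show ?thesis using ppt_values_has_max by (simp add: one_way_fidelity_def)
qed

end
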